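(* Let $p\in(0,1)$. The intensity measure $I\boldsymbol{\mu}^{\mathrm{rec}}_p$ of the recursive separable permuton is absolutely continuous with respect to Lebesgue measure on $[0,1]^2$ and has density $$(x,y)\mapsto\frac{1}{\Gamma(p)^2\,\Gamma(1-p)^2}\int_{\max(x+y-1,0)}^{\min(x,y)}\frac{dz}{z^{1-p}(x-z)^p(y-z)^p(1-x-y+z)^{1-p}}.$$
   Context: $\mathrm{Leb}$ is Lebesgue measure on $[0,1]$. A permuton is a Borel probability measure on $[0,1]^2$ with both marginals equal to $\mathrm{Leb}$. Recursive separable permuton $\boldsymbol{\mu}^{\mathrm{rec}}_p$: let $(U_j)_{j\ge1}$ be i.i.d. uniform in $[0,1]$ and $(S_j)_{j\ge1}$ be i.i.d. signs in $\{\oplus,\ominus\}$ with $\mathbb P(S_j=\oplus)=p$, the two sequences being independent. For $x<y$ in $[0,1]$ let $j$ be the minimal index $j\ge 1$ such that $U_j\in(x,y]$; set $x\prec y$ if $S_j=\oplus$ and $y\prec x$ if $S_j=\ominus$ (no comparison if there is no such $j$). Let $\phi(x)=\mathrm{Leb}(\{y\in[0,1]: y\prec x\})$ and let $\boldsymbol{\mu}^{\mathrm{rec}}_p$ be the push-forward of $\mathrm{Leb}$ by $x\mapsto(x,\phi(x))$; this is almost surely a permuton. The intensity measure of a random measure $\boldsymbol{\mu}$ is $I\boldsymbol{\mu}(A)=\mathbb E[\boldsymbol{\mu}(A)]$ for all measurable $A$. *)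

theory Defs
  imports "HOL-Probability.Probability"
begin

abbreviation unit_square :: "(real \<times> real) set" where
  "unit_square \<equiv> {0..1} \<times> {0..1}"

abbreviation Leb :: "real measure" where
  "Leb \<equiv> restrict_space lborel {0..1}"

abbreviation Leb_square :: "(real \<times> real) measure" where
  "Leb_square \<equiv> restrict_space lborel unit_square"

datatype sign = Plus | Minus

text \<open>
  The sequences of uniforms and signs are indexed from \<open>0\<close> rather than from \<open>1\<close>.
  In the two definitions below, \<open>u\<close> and \<open>s\<close> are one realisation of these sequences, and
  \<open>x < y\<close> is intended in the first one.
\<close>

definition first_index :: "(nat \<Rightarrow> real) \<Rightarrow> real \<Rightarrow> real \<Rightarrow> nat" where
  "first_index u x y = (LEAST j. u j \<in> {x<..y})"

text \<open>
  \<open>rec_prec u s a b\<close> is the relation \<open>a \<prec> b\<close>. The first disjunct is the comparison of the pair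
  \<open>x = a < y = b\<close>, the second one that of \<open>x = b < y = a\<close>.
\<close>

definition rec_prec :: "(nat \<Rightarrow> real) \<Rightarrow> (nat \<Rightarrow> sign) \<Rightarrow> real \<Rightarrow> real \<Rightarrow> bool" where
  "rec_prec u s a b \<longleftrightarrow>
     (a < b \<and> (\<exists>j. u j \<in> {a<..b}) \<and> s (first_index u a b) = Plus) \<or>
     (b < a \<and> (\<exists>j. u j \<in> {b<..a}) \<and> s (first_index u b a) = Minus)"

definition rec_phi :: "(nat \<Rightarrow> real) \<Rightarrow> (nat \<Rightarrow> sign) \<Rightarrow> real \<Rightarrow> real" where
  "rec_phi u s x = measure Leb {y \<in> {0..1}. rec_prec u s y x}"

definition rec_permuton :: "(nat \<Rightarrow> real) \<Rightarrow> (nat \<Rightarrow> sign) \<Rightarrow> (real \<times> real) measure" where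
  "rec_permuton u s = distr Leb (restrict_space borel unit_square) (\<lambda>x. (x, rec_phi u s x))"

text \<open>
  Intensity measure, on the measurable space of \<open>N\<close>, of the random measure \<open>\<mu>\<close> defined on the
  probability space \<open>M\<close>.
\<close>

definition intensity_measure :: "'a measure \<Rightarrow> 'b measure \<Rightarrow> ('a \<Rightarrow> 'b measure) \<Rightarrow> 'b measure" where
  "intensity_measure M N \<mu> =
     measure_of (space N) (sets N) (\<lambda>A. \<integral>\<^sup>+ \<omega>. emeasure (\<mu> \<omega>) A \<partial>M)"

text \<open>
  The integral is taken in \<open>ennreal\<close>, since it may be infinite on the null set where \<open>x = y\<close> or
  \<open>x + y = 1\<close>. At the endpoints of the interval of integration the integrand is \<open>1 / 0 = 0\<close>.
\<close>

definition rec_density :: "real \<Rightarrow> real \<times> real \<Rightarrow> ennreal" where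
  "rec_density p = (\<lambda>(x, y).
     ennreal (1 / ((Gamma p)\<^sup>2 * (Gamma (1 - p))\<^sup>2)) *
     (\<integral>\<^sup>+ z \<in> {max (x + y - 1) 0..min x y}.
        ennreal (1 / (z powr (1 - p) * (x - z) powr p * (y - z) powr p *
                      (1 - x - y + z) powr (1 - p))) \<partial>lborel))"

end

theory Submission
  imports Defs "HOL-Real_Asymp.Real_Asymp"
begin

text \<open>
  The intensity measure is the law of the point \<open>(X, \<phi>(X))\<close> with \<open>X\<close> uniform and independent of
  the driving sequences, so by Fubini everything reduces to the law of \<open>\<phi>(x)\<close> for a fixed \<open>x\<close>
  in the open unit interval.

  Write \<open>\<phi>(x) = A + B\<close>, where \<open>A\<close> is the mass of the points preceding \<open>x\<close> on its left and \<open>B\<close> the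
  mass of those on its right. The successive cuts \<open>U j\<close> in \<open>(0, x]\<close> that come closer to \<open>x\<close> than
  all earlier ones perform a uniform stick breaking of \<open>[0, x]\<close>, and each broken off stick precedes
  \<open>x\<close> exactly if its sign is \<open>Plus\<close>, that is, with probability \<open>p\<close>. Hence \<open>A / x\<close> has the law
  \<open>Beta(p, 1 - p)\<close>. On the right the same happens with \<open>Minus\<close> instead of \<open>Plus\<close>, so
  \<open>B / (1 - x)\<close> has the law \<open>Beta(1 - p, p)\<close>; and \<open>A\<close>, \<open>B\<close> are independent because the
  cuts on the two sides of \<open>x\<close>, with their signs, form two independent sequences. The stated density is the convolution of the two scaled beta densities.

  The proof turns stick breaking into an integral equation. Let \<open>R(l, r)\<close> be the characteristic
  function, at a fixed argument \<open>t\<close>, of the mass of the points of \<open>[x - l, x + r)\<close> that precede \<open>x\<close>.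
  Conditioning on the first cut expresses \<open>(l + r) R(l, r)\<close> by the values of \<open>R\<close> on smaller
  intervals (\<open>mass_char_one_step\<close>). The product of the characteristic functions of the two scaled
  beta laws satisfies the same equation (\<open>arcsine_char_integral_equation\<close>), because of an integration
  by parts against the beta density (\<open>arcsine_law_stein\<close>). Two solutions that both equal
  \<open>1 + O(l + r)\<close> coincide, since the equation contracts the constant in such a bound by the factor
  \<open>3/4\<close> (\<open>triangular_integral_inequality_imp_zero\<close>). So the two characteristic functions agree
  (\<open>mass_char_eq\<close>), and Levy's uniqueness theorem identifies the law of \<open>\<phi>(x)\<close>
  (\<open>distr_mass_below\<close>).
\<close>

section \<open>The generalised arcsine law\<close>

text \<open>
  For \<open>l > 0\<close>, the density of \<open>l\<close> times a \<open>Beta(p, 1 - p)\<close> variable, known for \<open>l = 1\<close> as the generalised arcsine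
  density. The convention \<open>1 / 0 = 0\<close> makes it vanish at both endpoints, which matches the integrand
  of \<open>rec_density\<close> pointwise.
\<close>

definition arcsine_density :: "real \<Rightarrow> real \<Rightarrow> real \<Rightarrow> real" where
  "arcsine_density p l z =
     indicator {0..l} z / (Gamma p * Gamma (1 - p) * (z powr (1 - p) * (l - z) powr p))"

definition arcsine_law :: "real \<Rightarrow> real measure" where
  "arcsine_law p = density lborel (\<lambda>w. ennreal (arcsine_density p 1 w))"

lemma arcsine_density_measurable [measurable]: "arcsine_density p l \<in> borel_measurable borel"
  unfolding arcsine_density_def[abs_def] by measurable

lemma sets_arcsine_law [measurable_cong, simp]: "sets (arcsine_law p) = sets borel"
  by (simp add: arcsine_law_def)

lemma space_arcsine_law [simp]: "space (arcsine_law p) = UNIV"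
  by (simp add: arcsine_law_def)

lemma arcsine_density_nonneg:
  assumes "0 < p" "p < 1" shows "0 \<le> arcsine_density p l z"
  using assms by (auto simp: arcsine_density_def intro!: divide_nonneg_nonneg mult_nonneg_nonneg less_imp_le[OF Gamma_real_pos])

lemma arcsine_density_eq:
  assumes "0 < w" "w < 1"
  shows "arcsine_density p 1 w = w powr (p - 1) * (1 - w) powr (- p) / (Gamma p * Gamma (1 - p))"
proof -
  have "w powr (p - 1) = inverse (w powr (1 - p))" "(1 - w) powr (- p) = inverse ((1 - w) powr p)"
    using powr_minus[of w "1 - p"] powr_minus[of "1 - w" p] by auto
  then show ?thesis using assms by (simp add: arcsine_density_def divide_inverse)
qed

lemma prob_space_arcsine_law:
  assumes p: "0 < p" "p < 1" shows "prob_space (arcsine_law p)"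
proof
  let ?f = "\<lambda>t. if t \<in> {0..1} then t powr (p - 1) * (1 - t) powr ((1 - p) - 1) else 0 :: real"
  let ?c = "Gamma p * Gamma (1 - p)"
  have c: "?c > 0" using p by (auto intro!: mult_pos_pos Gamma_real_pos)
  have "((\<lambda>t. t powr (p - 1) * (1 - t) powr ((1 - p) - 1)) has_integral Beta p (1 - p)) {0..1}"
    using p by (intro has_integral_Beta_real) auto
  then have "(?f has_integral Beta p (1 - p)) UNIV"
    by (subst has_integral_restrict_UNIV)
  moreover have "Beta p (1 - p) = ?c" using p by (simp add: Beta_def)
  ultimately have "((\<lambda>t. ?f t / ?c) has_integral (?c / ?c)) UNIV"
    by (intro has_integral_divide) auto
  moreover have "?c / ?c = 1" using c by (metis divide_self less_irrefl)
  ultimately have "((\<lambda>t. ?f t / ?c) has_integral 1) UNIV" by (simp only:)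
  then have "(\<integral>\<^sup>+ t. ennreal (?f t / ?c) \<partial>lborel) = ennreal 1"
    using c by (intro nn_integral_has_integral_lborel) auto
  moreover have "(\<integral>\<^sup>+ t. ennreal (arcsine_density p 1 t) \<partial>lborel) = (\<integral>\<^sup>+ t. ennreal (?f t / ?c) \<partial>lborel)"
  proof (rule nn_integral_cong_AE)
    have "AE t in lborel. t \<noteq> (0::real) \<and> t \<noteq> 1"
      using AE_lborel_singleton[of "0::real"] AE_lborel_singleton[of "1::real"] by eventually_elim auto
    then show "AE t in lborel. ennreal (arcsine_density p 1 t) = ennreal (?f t / ?c)"
    proof eventually_elim
      case (elim t)
      show ?case
      proof (cases "0 < t \<and> t < 1")
        case True then show ?thesis by (simp add: arcsine_density_eq)
      next
        case False
        then have "t \<notin> {0..1}" using elim by auto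
        then show ?thesis by (auto simp: arcsine_density_def)
      qed
    qed
  qed
  ultimately show "emeasure (arcsine_law p) (space (arcsine_law p)) = 1"
    by (simp add: arcsine_law_def emeasure_density)
qed

lemma real_distribution_arcsine_law:
  assumes "0 < p" "p < 1" shows "real_distribution (arcsine_law p)"
  by (rule real_distribution.intro[OF prob_space_arcsine_law[OF assms]])
     (unfold_locales, simp_all)

lemma AE_arcsine_law: "AE w in arcsine_law p. 0 < w \<and> w < 1"
proof -
  have "AE t in lborel. t \<noteq> (0::real) \<and> t \<noteq> 1"
    using AE_lborel_singleton[of "0::real"] AE_lborel_singleton[of "1::real"] by eventually_elim auto
  then have "AE w in lborel. 0 < ennreal (arcsine_density p 1 w) \<longrightarrow> 0 < w \<and> w < 1"
    by eventually_elim (auto simp: arcsine_density_def indicator_def split: if_splits)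
  then show ?thesis
    unfolding arcsine_law_def by (subst AE_density) auto
qed

lemma integral_arcsine_law:
  fixes f :: "real \<Rightarrow> complex"
  assumes p: "0 < p" "p < 1" and [measurable]: "f \<in> borel_measurable borel"
  shows "(\<integral>w. f w \<partial>arcsine_law p) = (LBINT w=0..1. arcsine_density p 1 w *\<^sub>R f w)"
proof -
  have "(\<integral>w. f w \<partial>arcsine_law p) = (\<integral>w. arcsine_density p 1 w *\<^sub>R f w \<partial>lborel)"
    unfolding arcsine_law_def using p
    by (intro integral_density) (auto simp: arcsine_density_nonneg)
  also have "\<dots> = (\<integral>w. indicator {0<..<1} w *\<^sub>R (arcsine_density p 1 w *\<^sub>R f w) \<partial>lborel)"
  proof (rule integral_cong_AE)
    show "AE w in lborel. arcsine_density p 1 w *\<^sub>R f w = indicator {0<..<1} w *\<^sub>R (arcsine_density p 1 w *\<^sub>R f w)"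
      using AE_lborel_singleton[of "0::real"] AE_lborel_singleton[of "1::real"]
      by eventually_elim (auto simp: arcsine_density_def indicator_def)
  qed auto
  also have "\<dots> = (LBINT w=0..1. arcsine_density p 1 w *\<^sub>R f w)"
    by (simp add: interval_lebesgue_integral_def set_lebesgue_integral_def zero_ereal_def one_ereal_def)
  finally show ?thesis .
qed

text \<open>
  An integration by parts against the density, in the manner of Stein's method. Up to the
  factor \<open>1 / (\<Gamma>(p) \<Gamma>(1 - p))\<close>, the function
  \<open>K(w) = (G(1) - G(w)) w\<^sup>p (1 - w)\<^sup>-\<^sup>p - (G(w) - G(0)) w\<^sup>p\<^sup>-\<^sup>1 (1 - w)\<^sup>1\<^sup>-\<^sup>p\<close> has as derivative the density
  times the difference of the two integrands, and it vanishes at both ends of the unit interval.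
  Since the first difference quotient is the mean of \<open>g\<close> over \<open>[w, 1]\<close> and the second one its mean over
  \<open>[0, w]\<close>, the identity says that the law of \<open>W\<close> is unchanged by breaking off a uniform stick:
  replacing \<open>W\<close> by \<open>V + (1 - V) W\<close> with probability \<open>p\<close> and by \<open>(1 - V) W\<close> otherwise.
\<close>

lemma arcsine_law_stein:
  fixes G g :: "real \<Rightarrow> complex"
  assumes p: "0 < p" "p < 1"
    and G: "\<And>w. (G has_vector_derivative g w) (at w)"
    and g: "continuous_on UNIV g" "\<And>w. norm (g w) \<le> C"
  shows "(\<integral>w. p *\<^sub>R ((G 1 - G w) /\<^sub>R (1 - w)) + (1 - p) *\<^sub>R ((G w - G 0) /\<^sub>R w) \<partial>arcsine_law p)
       = (\<integral>w. g w \<partial>arcsine_law p)"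
proof -
  interpret W: real_distribution "arcsine_law p" using p by (rule real_distribution_arcsine_law)
  define h where "h w = p *\<^sub>R ((G 1 - G w) /\<^sub>R (1 - w)) + (1 - p) *\<^sub>R ((G w - G 0) /\<^sub>R w)" for w
  define \<kappa> where "\<kappa> = 1 / (Gamma p * Gamma (1 - p))"
  define K where "K w = (\<kappa> * (w powr p * (1 - w) powr (- p))) *\<^sub>R (G 1 - G w)
      - (\<kappa> * (w powr (p - 1) * (1 - w) powr (1 - p))) *\<^sub>R (G w - G 0)" for w
  have Gamma_nonzero: "Gamma p \<noteq> 0" "Gamma (1 - p) \<noteq> 0"
    using p Gamma_real_pos[of p] Gamma_real_pos[of "1 - p"] by (metis less_irrefl diff_gt_0_iff_gt)+
  have \<kappa>: "\<kappa> > 0" using p by (simp add: \<kappa>_def Gamma_real_pos)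
  have C: "C \<ge> 0" using g(2)[of 0] norm_ge_zero order_trans by blast
  have Gcont: "continuous_on UNIV G"
    using G by (meson continuous_at_imp_continuous_on has_vector_derivative_continuous)
  have [measurable]: "G \<in> borel_measurable borel" "g \<in> borel_measurable borel"
    using Gcont g(1) by (auto intro: borel_measurable_continuous_onI)
  \<comment> \<open>keeps both difference quotients bounded, although they are singular at the endpoints\<close>
  have lip: "norm (G a - G b) \<le> C * \<bar>a - b\<bar>" for a b
  proof -
    have "norm (G a - G b) \<le> C * norm (a - b)"
    proof (rule differentiable_bound[where S = UNIV and f' = "\<lambda>w h. h *\<^sub>R g w"])
      show "onorm (\<lambda>h. h *\<^sub>R g w) \<le> C" for w
        using mult_left_mono[OF g(2)[of w] abs_ge_zero] by (intro onorm_le) (auto simp: mult.commute)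
    qed (use G in \<open>auto simp: has_vector_derivative_def\<close>)
    then show ?thesis by simp
  qed
  have hbound: "norm (h w) \<le> C" if "0 < w" "w < 1" for w
  proof -
    have quot: "norm (x /\<^sub>R a) \<le> C" if "norm x \<le> C * a" "0 < a" for x :: complex and a
      using that by (simp add: field_simps)
    have "norm ((G 1 - G w) /\<^sub>R (1 - w)) \<le> C" "norm ((G w - G 0) /\<^sub>R w) \<le> C"
      by (rule quot; use lip[of 1 w] lip[of w 0] that in simp)+
    then have "p * norm ((G 1 - G w) /\<^sub>R (1 - w)) + (1 - p) * norm ((G w - G 0) /\<^sub>R w) \<le> p * C + (1 - p) * C"
      using p by (intro add_mono mult_left_mono) auto
    moreover have "norm (h w) \<le> p * norm ((G 1 - G w) /\<^sub>R (1 - w)) + (1 - p) * norm ((G w - G 0) /\<^sub>R w)"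
      unfolding h_def using p that by (intro norm_triangle_le) (auto simp: abs_mult)
    ultimately show ?thesis by (simp add: algebra_simps)
  qed
  have [measurable]: "h \<in> borel_measurable borel"
    unfolding h_def[abs_def] by measurable
  have int_h: "integrable (arcsine_law p) h"
    by (intro W.integrable_const_bound[where B = C] eventually_mono[OF AE_arcsine_law[of p]])
       (auto simp: hbound)
  have int_g: "integrable (arcsine_law p) g"
    using g(2) by (intro W.integrable_const_bound[where B = C]) auto
  have deriv: "(K has_vector_derivative arcsine_density p 1 w *\<^sub>R (h w - g w)) (at w)"
    if w: "0 < w" "w < 1" for w
  proof -
    have pw: "w powr p = w * w powr (p - 1)" "(1 - w) powr (1 - p) = (1 - w) * (1 - w) powr (- p)"
      "w powr (p - 2) = w powr (p - 1) / w" "(1 - w) powr (- p - 1) = (1 - w) powr (- p) / (1 - w)"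
      using w by (auto simp: powr_diff powr_minus field_simps power2_eq_square)
    have d1: "((\<lambda>w. \<kappa> * (w powr p * (1 - w) powr (- p))) has_real_derivative
        \<kappa> * (p * w powr (p - 1) * (1 - w) powr (- p) / (1 - w))) (at w)"
      using w by (auto intro!: derivative_eq_intros simp: pw) (simp add: field_simps pw power2_eq_square)
    have d2: "((\<lambda>w. \<kappa> * (w powr (p - 1) * (1 - w) powr (1 - p))) has_real_derivative
        - (\<kappa> * ((1 - p) * w powr (p - 1) * (1 - w) powr (- p) / w))) (at w)"
      using w by (auto intro!: derivative_eq_intros simp: pw) (simp add: field_simps pw)
    have "(K has_vector_derivative
        ((\<kappa> * (w powr p * (1 - w) powr (- p))) *\<^sub>R (0 - g w) +
         (\<kappa> * (p * w powr (p - 1) * (1 - w) powr (- p) / (1 - w))) *\<^sub>R (G 1 - G w)) -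
        ((\<kappa> * (w powr (p - 1) * (1 - w) powr (1 - p))) *\<^sub>R (g w - 0) +
         (- (\<kappa> * ((1 - p) * w powr (p - 1) * (1 - w) powr (- p) / w))) *\<^sub>R (G w - G 0))) (at w)"
      unfolding K_def[abs_def]
      by (intro has_vector_derivative_diff has_vector_derivative_scaleR d1 d2 G has_vector_derivative_const)
    moreover have "((\<kappa> * (w powr p * (1 - w) powr (- p))) *\<^sub>R (0 - g w) +
         (\<kappa> * (p * w powr (p - 1) * (1 - w) powr (- p) / (1 - w))) *\<^sub>R (G 1 - G w)) -
        ((\<kappa> * (w powr (p - 1) * (1 - w) powr (1 - p))) *\<^sub>R (g w - 0) +
         (- (\<kappa> * ((1 - p) * w powr (p - 1) * (1 - w) powr (- p) / w))) *\<^sub>R (G w - G 0))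
       = arcsine_density p 1 w *\<^sub>R (h w - g w)"
    proof -
      define q where "q = \<kappa> * (w powr (p - 1) * (1 - w) powr (- p))"
      have dq: "arcsine_density p 1 w = q"
        using w by (simp add: arcsine_density_eq q_def \<kappa>_def)
      have qs: "\<kappa> * (w powr p * (1 - w) powr (- p)) = q * w"
        "\<kappa> * (p * w powr (p - 1) * (1 - w) powr (- p) / (1 - w)) = q * (p / (1 - w))"
        "\<kappa> * (w powr (p - 1) * (1 - w) powr (1 - p)) = q * (1 - w)"
        "\<kappa> * ((1 - p) * w powr (p - 1) * (1 - w) powr (- p) / w) = q * ((1 - p) / w)"
        using w by (auto simp: q_def pw)
      have alg: "(q * w) *\<^sub>R (0 - g') + (q * (p * i)) *\<^sub>R a - ((q * (1 - w)) *\<^sub>R (g' - 0) + (- (q * ((1 - p) * j))) *\<^sub>R b)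
          = q *\<^sub>R (p *\<^sub>R (i *\<^sub>R a) + (1 - p) *\<^sub>R (j *\<^sub>R b) - g')" for a b g' :: complex and i j :: real
        by (simp add: scaleR_conv_of_real algebra_simps)
      show ?thesis
        unfolding qs dq h_def unfolding divide_inverse by (rule alg)
    qed
    ultimately show ?thesis by simp
  qed
  have hcont: "isCont (\<lambda>w. arcsine_density p 1 w *\<^sub>R (h w - g w)) w" if w: "0 < w" "w < 1" for w
  proof -
    have "isCont G w" "isCont g w"
      using Gcont g(1) by (auto simp: continuous_on_eq_continuous_at)
    then have cont: "isCont (\<lambda>w. (w powr (p - 1) * (1 - w) powr (- p) / (Gamma p * Gamma (1 - p))) *\<^sub>R (h w - g w)) w"
      unfolding h_def[abs_def] using w Gamma_nonzero by (intro continuous_intros) auto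
    have ev: "eventually (\<lambda>w. (w powr (p - 1) * (1 - w) powr (- p) / (Gamma p * Gamma (1 - p))) *\<^sub>R (h w - g w)
        = arcsine_density p 1 w *\<^sub>R (h w - g w)) (nhds w)"
      using eventually_nhds_in_open[of "{0<..<1}" w] w
      by (auto elim!: eventually_mono simp: arcsine_density_eq)
    show ?thesis by (rule iffD1[OF isCont_cong[OF ev] cont])
  qed
  have Kbound: "norm (K w) \<le> 2 * \<kappa> * C * (w powr p * (1 - w) powr (1 - p))" if w: "0 < w" "w < 1" for w
  proof -
    have "norm (K w) \<le> (\<kappa> * (w powr p * (1 - w) powr (- p))) * (C * (1 - w))
        + (\<kappa> * (w powr (p - 1) * (1 - w) powr (1 - p))) * (C * w)"
      unfolding K_def using lip[of 1 w] lip[of w 0] w \<kappa>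
      by (intro norm_triangle_le_diff add_mono) (auto simp: abs_mult intro!: mult_left_mono)
    also have "\<dots> = 2 * \<kappa> * C * (w powr p * (1 - w) powr (1 - p))"
      using w by (simp add: powr_diff powr_minus field_simps)
    finally show ?thesis .
  qed
  have blim: "((\<lambda>w. 2 * \<kappa> * C * (w powr p * (1 - w) powr (1 - p))) \<longlongrightarrow> 0) (at_right 0)"
    "((\<lambda>w. 2 * \<kappa> * C * (w powr p * (1 - w) powr (1 - p))) \<longlongrightarrow> 0) (at_left 1)"
    using p by real_asymp+
  have K0: "(K \<longlongrightarrow> 0) (at_right 0)"
    by (rule Lim_null_comparison[OF _ blim(1)])
       (use eventually_at_right_real[of 0 1] Kbound in \<open>auto elim!: eventually_mono\<close>)
  have K1: "(K \<longlongrightarrow> 0) (at_left 1)"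
    by (rule Lim_null_comparison[OF _ blim(2)])
       (use eventually_at_left_real[of 0 1] Kbound in \<open>auto elim!: eventually_mono\<close>)
  have "(\<integral>w. h w - g w \<partial>arcsine_law p) = (LBINT w=0..1. arcsine_density p 1 w *\<^sub>R (h w - g w))"
    using p by (intro integral_arcsine_law) auto
  also have "\<dots> = 0 - 0"
  proof (rule interval_integral_FTC_integrable[where F = K])
    have "integrable lborel (\<lambda>w. arcsine_density p 1 w *\<^sub>R (h w - g w))"
      using Bochner_Integration.integrable_diff[OF int_h int_g] p
      unfolding arcsine_law_def by (subst (asm) integrable_density) (auto simp: arcsine_density_nonneg)
    then show "set_integrable lborel (einterval 0 1) (\<lambda>w. arcsine_density p 1 w *\<^sub>R (h w - g w))"
      unfolding set_integrable_def by (intro integrable_mult_indicator) auto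
  qed (use deriv hcont K0 K1 in \<open>auto simp: zero_ereal_def one_ereal_def ereal_tendsto_simps\<close>)
  finally have "(\<integral>w. h w - g w \<partial>arcsine_law p) = 0" by simp
  then show ?thesis
    using int_h int_g by (simp add: h_def[abs_def])
qed

text \<open>
  The stick breaking identity for exponentials. For a fixed value \<open>w\<close> of the arcsine variable the
  integral over \<open>v\<close> is elementary and produces the two difference quotients of \<open>arcsine_law_stein\<close>,
  for an antiderivative \<open>G\<close> of \<open>w \<mapsto> l exp (i t l w)\<close>.
\<close>

lemma arcsine_char_integral_equation:
  assumes p: "0 < p" "p < 1" and l: "0 \<le> l"
  shows "(LINT v:{0..l}|lborel. (p *\<^sub>R iexp (t * v) + of_real (1 - p)) * char (arcsine_law p) (t * (l - v)))
       = l *\<^sub>R char (arcsine_law p) (t * l)"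
proof (cases "t = 0")
  case True
  interpret W: real_distribution "arcsine_law p" using p by (rule real_distribution_arcsine_law)
  have "p *\<^sub>R 1 + complex_of_real (1 - p) = 1" by (simp add: scaleR_conv_of_real)
  then show ?thesis
    using True l by (simp add: W.char_zero set_lebesgue_integral_def scaleR_conv_of_real)
next
  case t: False
  interpret W: real_distribution "arcsine_law p" using p by (rule real_distribution_arcsine_law)
  interpret pair_sigma_finite lborel "arcsine_law p" ..
  define c where "c = \<i> * complex_of_real t"
  have c: "c \<noteq> 0" using t by (simp add: c_def)
  define G where "G w = iexp (t * l * w) / c" for w
  define g where "g w = l *\<^sub>R iexp (t * l * w)" for w
  define F where "F v w = indicator {0..l} v *\<^sub>R ((p *\<^sub>R iexp (t * v) + of_real (1 - p)) * iexp (t * (l - v) * w))"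
    for v w :: real
  have G_deriv: "(G has_vector_derivative g w) (at w)" for w
  proof -
    have "((\<lambda>z. exp (c * l * z) / c) has_field_derivative of_real l * exp (c * l * of_real w)) (at (of_real w))"
      using c by (auto intro!: derivative_eq_intros)
    from has_vector_derivative_real_field[OF this, of UNIV] show ?thesis
      by (simp add: G_def[abs_def] g_def c_def scaleR_conv_of_real algebra_simps)
  qed
  have inner: "(\<integral>v. F v w \<partial>lborel) = p *\<^sub>R ((G 1 - G w) /\<^sub>R (1 - w)) + (1 - p) *\<^sub>R ((G w - G 0) /\<^sub>R w)"
    if w: "0 < w" "w < 1" for w
  proof -
    define P where "P z = of_real p * exp (c * (z + (l - z) * w)) / (c * (1 - w)) - of_real (1 - p) * exp (c * ((l - z) * w)) / (c * w)"
      for z :: complex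
    define f where "f v = (p *\<^sub>R iexp (t * v) + of_real (1 - p)) * iexp (t * (l - v) * w)" for v
    have f: "f v = of_real p * exp (c * (v + (l - v) * w)) + of_real (1 - p) * exp (c * ((l - v) * w))" for v
      by (simp add: f_def c_def algebra_simps exp_add[symmetric] scaleR_conv_of_real)
    have w': "1 - complex_of_real w \<noteq> 0" "complex_of_real w \<noteq> 0"
      using w by (auto simp: complex_eq_iff)
    have "(P has_field_derivative f v) (at (of_real v))" for v
    proof -
      have d1: "((\<lambda>z. exp (c * (z + (l - z) * w))) has_field_derivative exp (c * (v + (l - v) * w)) * (c * (1 - w))) (at (of_real v))"
        by (auto intro!: derivative_eq_intros)
      have d2: "((\<lambda>z. exp (c * ((l - z) * w))) has_field_derivative exp (c * ((l - v) * w)) * (- (c * w))) (at (of_real v))"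
        by (auto intro!: derivative_eq_intros)
      have "(P has_field_derivative
          of_real p * (exp (c * (v + (l - v) * w)) * (c * (1 - w))) / (c * (1 - w)) -
          of_real (1 - p) * (exp (c * ((l - v) * w)) * (- (c * w))) / (c * w)) (at (of_real v))"
        unfolding P_def[abs_def] by (intro DERIV_diff DERIV_cdivide DERIV_cmult d1 d2)
      then show ?thesis unfolding f using c w' by simp
    qed
    then have "((\<lambda>v. P (of_real v)) has_vector_derivative f v) (at v within {0..l})" for v
      by (rule has_vector_derivative_real_field)
    moreover have "continuous_on {0..l} f"
      unfolding f_def by (intro continuous_intros)
    ultimately have "(\<integral>v. indicator {0..l} v *\<^sub>R f v \<partial>lborel) = P (of_real l) - P (of_real 0)"
      using l by (intro integral_FTC_Icc) auto
    also have "\<dots> = p *\<^sub>R ((G 1 - G w) /\<^sub>R (1 - w)) + (1 - p) *\<^sub>R ((G w - G 0) /\<^sub>R w)"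
    proof -
      define e where "e x = exp (c * of_real l * of_real x)" for x :: real
      have Ge: "G x = e x / c" for x by (simp add: G_def e_def c_def algebra_simps)
      have Pe: "P (of_real l) = of_real p * e 1 / (c * (1 - w)) - of_real (1 - p) * e 0 / (c * w)"
        "P (of_real 0) = of_real p * e w / (c * (1 - w)) - of_real (1 - p) * e w / (c * w)"
        by (simp_all add: P_def e_def mult.assoc)
      show ?thesis
        unfolding Ge Pe divide_inverse inverse_mult_distrib
        by (simp add: scaleR_conv_of_real algebra_simps)
    qed
    finally show ?thesis by (simp add: F_def f_def)
  qed
  have norm_coeff: "norm (p *\<^sub>R iexp (t * v) + of_real (1 - p)) \<le> 1" for v
    using norm_triangle_ineq[of "p *\<^sub>R iexp (t * v)" "of_real (1 - p)"] p
    by (simp del: of_real_diff of_real_mult)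
  have "integrable (lborel \<Otimes>\<^sub>M arcsine_law p) (case_prod F)"
  proof (rule integrableI_bounded_set[where A = "{0..l} \<times> UNIV" and B = 1])
    show "case_prod F \<in> borel_measurable (lborel \<Otimes>\<^sub>M arcsine_law p)"
      unfolding F_def by measurable
    have "emeasure (lborel \<Otimes>\<^sub>M arcsine_law p) ({0..l} \<times> UNIV) = ennreal l * 1"
      using W.emeasure_space_1 l by (subst W.emeasure_pair_measure_Times) auto
    then show "emeasure (lborel \<Otimes>\<^sub>M arcsine_law p) ({0..l} \<times> UNIV) < \<infinity>" by simp
    have "norm (F v w) \<le> 1" for v w
      using norm_coeff[of v] by (simp add: F_def norm_mult indicator_def del: of_real_mult of_real_diff)
    then show "AE x in lborel \<Otimes>\<^sub>M arcsine_law p. x \<in> {0..l} \<times> UNIV \<longrightarrow> norm (case_prod F x) \<le> 1"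
      by (auto split: prod.splits)
    show "AE x in lborel \<Otimes>\<^sub>M arcsine_law p. x \<notin> {0..l} \<times> UNIV \<longrightarrow> case_prod F x = 0"
      by (rule AE_I2) (auto simp: F_def indicator_def split: if_splits)
  qed auto
  then have "(\<integral>v. (\<integral>w. F v w \<partial>arcsine_law p) \<partial>lborel) = (\<integral>w. (\<integral>v. F v w \<partial>lborel) \<partial>arcsine_law p)"
    by (rule Fubini_integral[symmetric])
  also have "\<dots> = (\<integral>w. p *\<^sub>R ((G 1 - G w) /\<^sub>R (1 - w)) + (1 - p) *\<^sub>R ((G w - G 0) /\<^sub>R w) \<partial>arcsine_law p)"
  proof (rule integral_cong_AE)
    show "AE w in arcsine_law p. (\<integral>v. F v w \<partial>lborel) = p *\<^sub>R ((G 1 - G w) /\<^sub>R (1 - w)) + (1 - p) *\<^sub>R ((G w - G 0) /\<^sub>R w)"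
      using AE_arcsine_law[of p] by eventually_elim (use inner in auto)
    show "(\<lambda>w. \<integral>v. F v w \<partial>lborel) \<in> borel_measurable (arcsine_law p)"
      unfolding F_def by measurable
    show "(\<lambda>w. p *\<^sub>R ((G 1 - G w) /\<^sub>R (1 - w)) + (1 - p) *\<^sub>R ((G w - G 0) /\<^sub>R w)) \<in> borel_measurable (arcsine_law p)"
      unfolding G_def by measurable
  qed
  also have "\<dots> = (\<integral>w. g w \<partial>arcsine_law p)"
  proof (rule arcsine_law_stein[OF p G_deriv])
    show "continuous_on UNIV g" unfolding g_def by (intro continuous_intros)
    show "norm (g w) \<le> l" for w using l by (simp add: g_def del: of_real_mult)
  qed
  also have "\<dots> = l *\<^sub>R char (arcsine_law p) (t * l)"
    by (simp add: g_def char_def del: of_real_mult)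
  finally show ?thesis
    by (simp add: F_def char_def set_lebesgue_integral_def del: of_real_mult of_real_diff of_real_add)
qed

section \<open>The effect of the first cut on the order\<close>

text \<open>
  A form without \<open>LEAST\<close>, built from countably many conditions on single terms of the two
  sequences; measurability can be read off from it.
\<close>

lemma rec_prec_iff:
  "rec_prec u s a b \<longleftrightarrow>
     (\<exists>j. (a < u j \<and> u j \<le> b \<and> (\<forall>i<j. \<not> (a < u i \<and> u i \<le> b)) \<and> s j = Plus) \<or>
          (b < u j \<and> u j \<le> a \<and> (\<forall>i<j. \<not> (b < u i \<and> u i \<le> a)) \<and> s j = Minus))"
proof -
  have *: "((\<exists>j. u j \<in> {c<..d}) \<and> s (first_index u c d) = \<sigma>) \<longleftrightarrow>
      (\<exists>j. c < u j \<and> u j \<le> d \<and> (\<forall>i<j. \<not> (c < u i \<and> u i \<le> d)) \<and> s j = \<sigma>)" for c d \<sigma>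
  proof
    assume A: "(\<exists>j. u j \<in> {c<..d}) \<and> s (first_index u c d) = \<sigma>"
    then have "u (first_index u c d) \<in> {c<..d}"
      unfolding first_index_def by (metis LeastI)
    moreover have "u i \<notin> {c<..d}" if "i < first_index u c d" for i
      using that unfolding first_index_def by (rule not_less_Least)
    ultimately show "\<exists>j. c < u j \<and> u j \<le> d \<and> (\<forall>i<j. \<not> (c < u i \<and> u i \<le> d)) \<and> s j = \<sigma>"
      using A by (intro exI[of _ "first_index u c d"]) auto
  next
    assume "\<exists>j. c < u j \<and> u j \<le> d \<and> (\<forall>i<j. \<not> (c < u i \<and> u i \<le> d)) \<and> s j = \<sigma>"
    then obtain j where j: "u j \<in> {c<..d}" "\<forall>i<j. u i \<notin> {c<..d}" "s j = \<sigma>" by auto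
    then have "first_index u c d = j"
      unfolding first_index_def by (intro Least_equality) (auto simp: not_less[symmetric])
    with j show "(\<exists>j. u j \<in> {c<..d}) \<and> s (first_index u c d) = \<sigma>" by auto
  qed
  show ?thesis
    unfolding rec_prec_def *
    by (rule iffI) (auto intro: less_le_trans)
qed

lemma measurable_rec_prec [measurable (raw)]:
  assumes [measurable]: "\<And>j. (\<lambda>z. u z j) \<in> borel_measurable N" "\<And>j. (\<lambda>z. s z j) \<in> measurable N (count_space UNIV)"
    "a \<in> borel_measurable N" "b \<in> borel_measurable N"
  shows "Measurable.pred N (\<lambda>z. rec_prec (u z) (s z) (a z) (b z))"
  unfolding rec_prec_iff by measurable

lemma ex_nat_iff_zero_or_Suc: "(\<exists>j::nat. P j) \<longleftrightarrow> P 0 \<or> (\<exists>j. P (Suc j))"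
  by (metis not0_implies_Suc)

text \<open>
  The first cut decides the comparison if it separates the two points; otherwise the remaining
  sequences decide it.
\<close>

lemma rec_prec_case_nat:
  "rec_prec (case_nat v u) (case_nat \<sigma> s) y x \<longleftrightarrow>
     (if y < v \<and> v \<le> x then \<sigma> = Plus
      else if x < v \<and> v \<le> y then \<sigma> = Minus else rec_prec u s y x)"
proof -
  have hit: "first_index (case_nat v u) c d = 0" if "c < v" "v \<le> d" for c d
    using that by (auto simp: first_index_def)
  have miss: "first_index (case_nat v u) c d = Suc (first_index u c d)"
    if "\<not> (c < v \<and> v \<le> d)" "u j \<in> {c<..d}" for c d j
    unfolding first_index_def using that by (subst Least_Suc[where n = "Suc j"]) auto
  have ex: "(\<exists>j. case_nat v u j \<in> {c<..d}) \<longleftrightarrow> (c < v \<and> v \<le> d) \<or> (\<exists>j. u j \<in> {c<..d})" for c d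
    by (subst ex_nat_iff_zero_or_Suc) simp
  consider "y < v \<and> v \<le> x" | "x < v \<and> v \<le> y" | "\<not> (y < v \<and> v \<le> x)" "\<not> (x < v \<and> v \<le> y)" by blast
  then show ?thesis
  proof cases
    case 3
    then show ?thesis
      unfolding rec_prec_def ex using miss[of y x] miss[of x y] by auto
  qed (unfold rec_prec_def ex, auto simp: hit)
qed

text \<open>
  The interval is closed on the left and open on the right because a cut at \<open>v\<close> separates \<open>y\<close> from
  \<open>x\<close> if \<open>y < v \<le> x\<close> or \<open>x < v \<le> y\<close>: in both cases the interval splits at \<open>v\<close> into two intervals of
  the same kind, one of which is decided by the cut.
\<close>

definition mass_below :: "(nat \<Rightarrow> real) \<Rightarrow> (nat \<Rightarrow> sign) \<Rightarrow> real \<Rightarrow> real \<Rightarrow> real \<Rightarrow> real" where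
  "mass_below u s x l r = measure lborel {y \<in> {x - l..<x + r}. rec_prec u s y x}"

lemma emeasure_Ico_finite:
  fixes a b :: real
  assumes "A \<subseteq> {a..<b}" shows "emeasure lborel A \<noteq> \<infinity>"
  using assms by (intro less_imp_neq[OF emeasure_bounded_finite]) (rule bounded_subset[OF bounded_closed_interval[of a b]], auto)

lemma mass_below_split:
  fixes x l r m :: real
  assumes [measurable]: "Measurable.pred borel P" and "x - l \<le> m" "m \<le> x + r"
  shows "measure lborel {y \<in> {x - l..<x + r}. P y} =
    measure lborel {y \<in> {x - l..<m}. P y} + measure lborel {y \<in> {m..<x + r}. P y}"
proof -
  have "{y \<in> {x - l..<x + r}. P y} = {y \<in> {x - l..<m}. P y} \<union> {y \<in> {m..<x + r}. P y}"
    using assms by auto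
  moreover have "measure lborel ({y \<in> {x - l..<m}. P y} \<union> {y \<in> {m..<x + r}. P y}) =
      measure lborel {y \<in> {x - l..<m}. P y} + measure lborel {y \<in> {m..<x + r}. P y}"
  proof (rule measure_Union)
    show "emeasure lborel {y \<in> {x - l..<m}. P y} \<noteq> \<infinity>"
      by (rule emeasure_Ico_finite[of _ "x - l" m]) auto
    show "emeasure lborel {y \<in> {m..<x + r}. P y} \<noteq> \<infinity>"
      by (rule emeasure_Ico_finite[of _ m "x + r"]) auto
  qed (auto simp: disjoint_iff)
  ultimately show ?thesis by (simp only:)
qed

text \<open>
  The first cut removes from the interval the part that it separates from \<open>x\<close>; this part counts
  entirely or not at all, depending on the sign, and the rest is governed by the remaining sequences.
\<close>

lemma mass_below_case_nat:
  assumes "0 \<le> l" "0 \<le> r"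
  shows "mass_below (case_nat v u) (case_nat \<sigma> s) x l r =
     (if x - l < v \<and> v \<le> x then (if \<sigma> = Plus then v - (x - l) else 0) + mass_below u s x (x - v) r
      else if x < v \<and> v < x + r then (if \<sigma> = Minus then x + r - v else 0) + mass_below u s x l (v - x)
      else mass_below u s x l r)"
proof -
  let ?P = "\<lambda>y. rec_prec (case_nat v u) (case_nat \<sigma> s) y x"
  have P: "Measurable.pred borel ?P" by measurable
  consider "x - l < v \<and> v \<le> x" | "x < v \<and> v < x + r" | "\<not> (x - l < v \<and> v \<le> x)" "\<not> (x < v \<and> v < x + r)"
    by blast
  then show ?thesis
  proof cases
    case 1
    have lower: "{y \<in> {x - l..<v}. ?P y} = (if \<sigma> = Plus then {x - l..<v} else {})"
      using 1 by (auto simp: rec_prec_case_nat)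
    have upper: "{y \<in> {v..<x + r}. ?P y} = {y \<in> {x - (x - v)..<x + r}. rec_prec u s y x}"
      using 1 by (auto simp: rec_prec_case_nat)
    have "mass_below (case_nat v u) (case_nat \<sigma> s) x l r =
        measure lborel {y \<in> {x - l..<v}. ?P y} + measure lborel {y \<in> {v..<x + r}. ?P y}"
      unfolding mass_below_def using 1 assms by (intro mass_below_split[OF P]) auto
    then show ?thesis
      using 1 unfolding lower upper mass_below_def[symmetric] by (simp split: if_splits)
  next
    case 2
    have upper: "{y \<in> {v..<x + r}. ?P y} = (if \<sigma> = Minus then {v..<x + r} else {})"
      using 2 by (auto simp: rec_prec_case_nat)
    have lower: "{y \<in> {x - l..<v}. ?P y} = {y \<in> {x - l..<x + (v - x)}. rec_prec u s y x}"
      using 2 by (auto simp: rec_prec_case_nat)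
    have "mass_below (case_nat v u) (case_nat \<sigma> s) x l r =
        measure lborel {y \<in> {x - l..<v}. ?P y} + measure lborel {y \<in> {v..<x + r}. ?P y}"
      unfolding mass_below_def using 2 assms by (intro mass_below_split[OF P]) auto
    then show ?thesis
      using 2 unfolding lower upper mass_below_def[symmetric] by (simp split: if_splits)
  next
    case 3
    then have "{y \<in> {x - l..<x + r}. ?P y} = {y \<in> {x - l..<x + r}. rec_prec u s y x}"
      by (auto simp: rec_prec_case_nat)
    with 3 show ?thesis unfolding mass_below_def by (simp only: if_False)
  qed
qed

lemma mass_below_nonneg: "0 \<le> mass_below u s x l r"
  by (simp add: mass_below_def)

lemma mass_below_le:
  assumes "0 \<le> l" "0 \<le> r"
  shows "mass_below u s x l r \<le> l + r"
proof -
  have "mass_below u s x l r \<le> measure lborel {x - l..<x + r}"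
    unfolding mass_below_def
    using emeasure_Ico_finite[OF subset_refl, of "x - l" "x + r"]
    by (intro measure_mono_fmeasurable) (auto simp: fmeasurable_def less_top)
  then show ?thesis using assms by simp
qed

lemma measurable_mass_below [measurable (raw)]:
  assumes [measurable]: "\<And>j. (\<lambda>z. u z j) \<in> borel_measurable N" "\<And>j. (\<lambda>z. s z j) \<in> measurable N (count_space UNIV)"
    "x \<in> borel_measurable N" "l \<in> borel_measurable N" "r \<in> borel_measurable N"
  shows "(\<lambda>z. mass_below (u z) (s z) (x z) (l z) (r z)) \<in> borel_measurable N"
  unfolding mass_below_def atLeastLessThan_iff by measurable

section \<open>The law of the driving sequences\<close>

definition cut_law :: "real measure" where
  "cut_law = uniform_measure lborel {0..1}"

definition sign_law :: "real \<Rightarrow> sign measure" where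
  "sign_law p = measure_pmf (map_pmf (\<lambda>b. if b then Plus else Minus) (bernoulli_pmf p))"

definition driving_law :: "real \<Rightarrow> ((nat \<Rightarrow> real) \<times> (nat \<Rightarrow> sign)) measure" where
  "driving_law p = (\<Pi>\<^sub>M j\<in>UNIV. cut_law) \<Otimes>\<^sub>M (\<Pi>\<^sub>M j\<in>UNIV. sign_law p)"

lemma sets_cut_law [measurable_cong, simp]: "sets cut_law = sets borel"
  by (simp add: cut_law_def)

lemma space_cut_law [simp]: "space cut_law = UNIV"
  by (simp add: cut_law_def)

lemma sets_sign_law [measurable_cong, simp]: "sets (sign_law p) = sets (count_space UNIV)"
  by (simp add: sign_law_def)

lemma space_sign_law [simp]: "space (sign_law p) = UNIV"
  by (simp add: sign_law_def)

lemma prob_space_cut_law: "prob_space cut_law"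
  unfolding cut_law_def by (rule prob_space_uniform_measure) auto

lemma prob_space_sign_law: "prob_space (sign_law p)"
  unfolding sign_law_def by (rule prob_space_measure_pmf)

lemma sequence_space_cut_law: "sequence_space cut_law"
proof -
  interpret prob_space cut_law by (rule prob_space_cut_law)
  show ?thesis by unfold_locales
qed

lemma sequence_space_sign_law: "sequence_space (sign_law p)"
proof -
  interpret prob_space "sign_law p" by (rule prob_space_sign_law)
  show ?thesis by unfold_locales
qed

lemma sets_driving_law [measurable_cong]:
  "sets (driving_law p) = sets ((\<Pi>\<^sub>M j\<in>UNIV. borel) \<Otimes>\<^sub>M (\<Pi>\<^sub>M j\<in>UNIV. count_space UNIV))"
  unfolding driving_law_def by (intro sets_pair_measure_cong sets_PiM_cong) auto

lemma prob_space_driving_law: "prob_space (driving_law p)"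
proof -
  interpret A: sequence_space cut_law by (rule sequence_space_cut_law)
  interpret B: sequence_space "sign_law p" by (rule sequence_space_sign_law)
  interpret pair_prob_space A.S B.S by unfold_locales
  show ?thesis unfolding driving_law_def by unfold_locales
qed

lemma sign_UNIV: "(UNIV :: sign set) = {Plus, Minus}"
  using sign.exhaust by auto

lemma integral_sign_law:
  fixes f :: "sign \<Rightarrow> complex"
  assumes "0 \<le> p" "p \<le> 1"
  shows "(\<integral>\<sigma>. f \<sigma> \<partial>sign_law p) = p *\<^sub>R f Plus + (1 - p) *\<^sub>R f Minus"
proof -
  have "(\<integral>\<sigma>. f \<sigma> \<partial>sign_law p) = (\<integral>b. f (if b then Plus else Minus) \<partial>measure_pmf (bernoulli_pmf p))"
    unfolding sign_law_def by (rule integral_map_pmf)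
  also have "\<dots> = (\<Sum>b\<in>UNIV. pmf (bernoulli_pmf p) b *\<^sub>R f (if b then Plus else Minus))"
    by (rule integral_measure_pmf) auto
  finally show ?thesis using assms by (simp add: UNIV_bool add.commute)
qed

lemma integral_cut_law:
  fixes f :: "real \<Rightarrow> complex"
  assumes [measurable]: "f \<in> borel_measurable borel"
  shows "(\<integral>v. f v \<partial>cut_law) = (LINT v:{0..1}|lborel. f v)"
proof -
  have "cut_law = density lborel (\<lambda>v. ennreal (indicator {0..1} v))"
    by (simp add: cut_law_def uniform_measure_def ennreal_indicator divide_ennreal_def)
  then have "(\<integral>v. f v \<partial>cut_law) = (\<integral>v. f v \<partial>density lborel (\<lambda>v. ennreal (indicator {0..1} v)))"
    by (rule arg_cong)
  also have "\<dots> = (\<integral>v. indicator {0..1} v *\<^sub>R f v \<partial>lborel)"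
    by (rule integral_density) auto
  finally show ?thesis by (simp add: set_lebesgue_integral_def)
qed

lemma (in prob_space) integrable_bounded:
  fixes f :: "'a \<Rightarrow> complex"
  assumes "f \<in> borel_measurable M" "\<And>x. norm (f x) \<le> C"
  shows "integrable M f"
  using assms by (intro integrable_const_bound[where B = C]) auto

lemma (in prob_space) norm_integral_le_bound:
  fixes f :: "'a \<Rightarrow> complex"
  assumes "\<And>x. norm (f x) \<le> C"
  shows "norm (\<integral>x. f x \<partial>M) \<le> C"
proof (cases "integrable M f")
  case True
  have "norm (\<integral>x. f x \<partial>M) \<le> (\<integral>x. norm (f x) \<partial>M)" by (rule integral_norm_bound)
  also have "\<dots> \<le> C" using True assms by (intro integral_le_const) auto
  finally show ?thesis .
next
  case False
  moreover have "0 \<le> C" using norm_ge_zero assms[of undefined] by (rule order_trans)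
  ultimately show ?thesis by (simp add: not_integrable_integral_eq)
qed

lemma (in sequence_space) integral_PiM_iter:
  fixes f :: "(nat \<Rightarrow> 'a) \<Rightarrow> complex"
  assumes f [measurable]: "f \<in> borel_measurable S" and bound: "\<And>\<omega>. norm (f \<omega>) \<le> C"
  shows "(\<integral>\<omega>. f \<omega> \<partial>S) = (\<integral>v. (\<integral>\<omega>. f (case_nat v \<omega>) \<partial>S) \<partial>M)"
proof -
  interpret MS: pair_prob_space M S by unfold_locales
  have [measurable]: "(\<lambda>(v, \<omega>). case_nat v \<omega>) \<in> M \<Otimes>\<^sub>M S \<rightarrow>\<^sub>M S"
    by measurable
  have "(\<integral>\<omega>. f \<omega> \<partial>S) = (\<integral>z. f (case z of (v, \<omega>) \<Rightarrow> case_nat v \<omega>) \<partial>(M \<Otimes>\<^sub>M S))"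
    by (subst PiM_iter[symmetric], subst integral_distr) auto
  also have "\<dots> = (\<integral>v. (\<integral>\<omega>. f (case_nat v \<omega>) \<partial>S) \<partial>M)"
  proof (subst MS.integral_fst'[symmetric])
    show "integrable (M \<Otimes>\<^sub>M S) (\<lambda>z. f (case z of (v, \<omega>) \<Rightarrow> case_nat v \<omega>))"
      by (intro MS.integrable_bounded[where C = C] bound) measurable
  qed simp
  finally show ?thesis .
qed

text \<open>
  Conditioning on the first cut and the first sign: a sequence of independent identically
  distributed terms is distributed like a fresh term followed by such a sequence.
\<close>

lemma integral_driving_law_iter:
  fixes f :: "(nat \<Rightarrow> real) \<times> (nat \<Rightarrow> sign) \<Rightarrow> complex"
  assumes p: "0 \<le> p" "p \<le> 1"
    and f [measurable]: "f \<in> borel_measurable (driving_law p)" and bound: "\<And>\<omega>. norm (f \<omega>) \<le> C"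
  shows "(\<integral>\<omega>. f \<omega> \<partial>driving_law p) =
    (\<integral>v. p *\<^sub>R (\<integral>\<omega>. f (case_nat v (fst \<omega>), case_nat Plus (snd \<omega>)) \<partial>driving_law p)
        + (1 - p) *\<^sub>R (\<integral>\<omega>. f (case_nat v (fst \<omega>), case_nat Minus (snd \<omega>)) \<partial>driving_law p) \<partial>cut_law)"
proof -
  interpret A: sequence_space cut_law by (rule sequence_space_cut_law)
  interpret B: sequence_space "sign_law p" by (rule sequence_space_sign_law)
  interpret AB: pair_prob_space A.S B.S by unfold_locales
  interpret A1: pair_prob_space cut_law A.S by unfold_locales
  interpret B1: pair_prob_space "sign_law p" B.S by unfold_locales
  have D: "driving_law p = A.S \<Otimes>\<^sub>M B.S" by (simp add: driving_law_def)
  note f' [measurable] = f[unfolded D]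
  have split: "(\<integral>\<omega>. g \<omega> \<partial>(A.S \<Otimes>\<^sub>M B.S)) = (\<integral>u. (\<integral>s. g (u, s) \<partial>B.S) \<partial>A.S)"
    if "g \<in> borel_measurable (A.S \<Otimes>\<^sub>M B.S)" "\<And>\<omega>. norm (g \<omega>) \<le> C" for g :: "_ \<Rightarrow> complex"
    using that by (intro AB.integral_fst'[symmetric] AB.integrable_bounded)
  have meas [measurable]: "(\<lambda>\<omega>. f (case_nat v (fst \<omega>), case_nat \<sigma> (snd \<omega>))) \<in> borel_measurable (A.S \<Otimes>\<^sub>M B.S)"
    for v \<sigma> by measurable
  have norm_s: "norm (\<integral>s. f (u, h s) \<partial>B.S) \<le> C" for u h
    by (intro B.norm_integral_le_bound bound)
  have "(\<integral>\<omega>. f \<omega> \<partial>driving_law p) = (\<integral>u. (\<integral>s. f (u, s) \<partial>B.S) \<partial>A.S)"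
    unfolding D using f' bound by (rule split)
  also have "\<dots> = (\<integral>v. (\<integral>u. (\<integral>s. f (case_nat v u, s) \<partial>B.S) \<partial>A.S) \<partial>cut_law)"
    using norm_s[of _ "\<lambda>s. s"] by (intro A.integral_PiM_iter) auto
  also have "\<dots> = (\<integral>v. (\<integral>u. p *\<^sub>R (\<integral>s. f (case_nat v u, case_nat Plus s) \<partial>B.S)
      + (1 - p) *\<^sub>R (\<integral>s. f (case_nat v u, case_nat Minus s) \<partial>B.S) \<partial>A.S) \<partial>cut_law)"
  proof (intro Bochner_Integration.integral_cong refl)
    fix v u assume vu: "v \<in> space cut_law" "u \<in> space A.S"
    have "(\<lambda>s. f (case_nat v u, s)) \<in> borel_measurable B.S"
      using vu by measurable
    from B.integral_PiM_iter[OF this bound]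
    show "(\<integral>s. f (case_nat v u, s) \<partial>B.S) = p *\<^sub>R (\<integral>s. f (case_nat v u, case_nat Plus s) \<partial>B.S)
      + (1 - p) *\<^sub>R (\<integral>s. f (case_nat v u, case_nat Minus s) \<partial>B.S)"
      using p by (simp add: integral_sign_law)
  qed
  also have "\<dots> = (\<integral>v. p *\<^sub>R (\<integral>u. (\<integral>s. f (case_nat v u, case_nat Plus s) \<partial>B.S) \<partial>A.S)
      + (1 - p) *\<^sub>R (\<integral>u. (\<integral>s. f (case_nat v u, case_nat Minus s) \<partial>B.S) \<partial>A.S) \<partial>cut_law)"
  proof (intro Bochner_Integration.integral_cong refl)
    fix v
    have "integrable A.S (\<lambda>u. \<integral>s. f (case_nat v u, case_nat \<sigma> s) \<partial>B.S)" for \<sigma>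
      by (intro A.integrable_bounded[where C = C] norm_s) measurable
    then show "(\<integral>u. p *\<^sub>R (\<integral>s. f (case_nat v u, case_nat Plus s) \<partial>B.S)
      + (1 - p) *\<^sub>R (\<integral>s. f (case_nat v u, case_nat Minus s) \<partial>B.S) \<partial>A.S) =
      p *\<^sub>R (\<integral>u. (\<integral>s. f (case_nat v u, case_nat Plus s) \<partial>B.S) \<partial>A.S)
      + (1 - p) *\<^sub>R (\<integral>u. (\<integral>s. f (case_nat v u, case_nat Minus s) \<partial>B.S) \<partial>A.S)"
      by simp
  qed
  also have "\<dots> = (\<integral>v. p *\<^sub>R (\<integral>\<omega>. f (case_nat v (fst \<omega>), case_nat Plus (snd \<omega>)) \<partial>driving_law p)
        + (1 - p) *\<^sub>R (\<integral>\<omega>. f (case_nat v (fst \<omega>), case_nat Minus (snd \<omega>)) \<partial>driving_law p) \<partial>cut_law)"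
    unfolding D by (subst (1 2) split[OF meas bound]) simp
  finally show ?thesis .
qed


text \<open>
  A sign has only two values, so the probability of \<open>Plus\<close> determines its law.
\<close>

lemma distr_sign_eq_sign_law:
  assumes "prob_space M" and S [measurable]: "S \<in> measurable M (count_space UNIV)"
    and p: "0 \<le> p" "p \<le> 1" "measure M {\<omega> \<in> space M. S \<omega> = Plus} = p"
  shows "distr M (count_space UNIV) S = sign_law p"
proof (rule measure_eqI_finite)
  interpret prob_space M by fact
  interpret L: prob_space "sign_law p" by (rule prob_space_sign_law)
  fix \<sigma> :: sign
  have "measure (sign_law p) {Plus} = p"
  proof -
    have "(\<lambda>b. if b then Plus else Minus) -` {Plus} = {True}" by (auto split: if_splits)
    then show ?thesis
      unfolding sign_law_def measure_map_pmf using p by (simp add: measure_pmf_single)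
  qed
  moreover have "UNIV - {Plus} = {Minus}"
    using sign_UNIV by auto
  ultimately have L: "measure (sign_law p) {\<sigma>} = (if \<sigma> = Plus then p else 1 - p)"
    using L.prob_compl[of "{Plus}"] by (cases \<sigma>) auto
  have M: "measure (distr M (count_space UNIV) S) {\<sigma>} = (if \<sigma> = Plus then p else 1 - p)"
  proof (cases \<sigma>)
    case Plus
    then show ?thesis using p(3) by (simp add: measure_distr vimage_def Int_def conj_commute)
  next
    case Minus
    have "{\<omega> \<in> space M. S \<omega> = Minus} = space M - {\<omega> \<in> space M. S \<omega> = Plus}"
    proof -
      have "S \<omega> = Minus \<longleftrightarrow> S \<omega> \<noteq> Plus" for \<omega> by (cases "S \<omega>") auto
      then show ?thesis by auto
    qed
    then have "measure M {\<omega> \<in> space M. S \<omega> = Minus} = 1 - p"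
      using p(3) by (simp add: prob_compl)
    then show ?thesis using Minus by (simp add: measure_distr vimage_def Int_def conj_commute)
  qed
  interpret D: prob_space "distr M (count_space UNIV) S" by (rule prob_space_distr) fact
  show "emeasure (distr M (count_space UNIV) S) {\<sigma>} = emeasure (sign_law p) {\<sigma>}"
    using L M by (simp add: D.emeasure_eq_measure L.emeasure_eq_measure)
qed (auto simp: sign_UNIV)

text \<open>
  Independence within each of the two sequences makes its law a product measure; independence of
  the two sequences makes the joint law the product of these two.
\<close>

lemma distr_driving_sequences:
  assumes "prob_space M" and p: "0 \<le> p" "p \<le> 1"
    and U: "prob_space.indep_vars M (\<lambda>_. borel) U UNIV"
    and U_law: "\<And>j::nat. distr M borel (U j) = cut_law"
    and S: "prob_space.indep_vars M (\<lambda>_. count_space UNIV) S UNIV"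
    and S_law: "\<And>j::nat. measure M {\<omega> \<in> space M. S j \<omega> = Plus} = p"
    and US: "prob_space.indep_set M
           (sets (vimage_algebra (space M) (\<lambda>\<omega> j. U j \<omega>) (\<Pi>\<^sub>M j\<in>UNIV. borel)))
           (sets (vimage_algebra (space M) (\<lambda>\<omega> j. S j \<omega>) (\<Pi>\<^sub>M j\<in>UNIV. count_space UNIV)))"
  shows "(\<lambda>\<omega>. (\<lambda>j. U j \<omega>, \<lambda>j. S j \<omega>)) \<in> measurable M ((\<Pi>\<^sub>M j\<in>UNIV. borel) \<Otimes>\<^sub>M (\<Pi>\<^sub>M j\<in>UNIV. count_space UNIV))"
    and "distr M ((\<Pi>\<^sub>M j\<in>UNIV. borel) \<Otimes>\<^sub>M (\<Pi>\<^sub>M j\<in>UNIV. count_space UNIV)) (\<lambda>\<omega>. (\<lambda>j. U j \<omega>, \<lambda>j. S j \<omega>)) = driving_law p"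
proof -
  interpret prob_space M by fact
  have U_rv: "random_variable borel (U j)" and S_rv: "random_variable (count_space UNIV) (S j)" for j
    using U S by (auto simp: indep_vars_def)
  have U_seq: "(\<lambda>\<omega> j. U j \<omega>) \<in> measurable M (\<Pi>\<^sub>M j\<in>UNIV. borel)"
    and S_seq: "(\<lambda>\<omega> j. S j \<omega>) \<in> measurable M (\<Pi>\<^sub>M j\<in>UNIV. count_space UNIV)"
    by (rule measurable_PiM_single'; simp add: U_rv S_rv)+
  show "(\<lambda>\<omega>. (\<lambda>j. U j \<omega>, \<lambda>j. S j \<omega>)) \<in> measurable M ((\<Pi>\<^sub>M j\<in>UNIV. borel) \<Otimes>\<^sub>M (\<Pi>\<^sub>M j\<in>UNIV. count_space UNIV))"
    using U_seq S_seq by (rule measurable_Pair)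
  have U_distr: "distr M (\<Pi>\<^sub>M j\<in>UNIV. borel) (\<lambda>\<omega> j. U j \<omega>) = (\<Pi>\<^sub>M j\<in>UNIV. cut_law)"
    using U indep_vars_iff_distr_eq_PiM[where I = UNIV and M' = "\<lambda>_. borel" and X = U] U_rv
    by (simp add: U_law restrict_def)
  have S_distr: "distr M (\<Pi>\<^sub>M j\<in>UNIV. count_space UNIV) (\<lambda>\<omega> j. S j \<omega>) = (\<Pi>\<^sub>M j\<in>UNIV. sign_law p)"
    using S indep_vars_iff_distr_eq_PiM[where I = UNIV and M' = "\<lambda>_. count_space UNIV" and X = S] S_rv
    by (simp add: restrict_def distr_sign_eq_sign_law[OF \<open>prob_space M\<close> _ p S_law])
  interpret DU: prob_space "distr M (\<Pi>\<^sub>M j\<in>UNIV. borel) (\<lambda>\<omega> j. U j \<omega>)"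
    using U_seq by (rule prob_space_distr)
  interpret DS: prob_space "distr M (\<Pi>\<^sub>M j\<in>UNIV. count_space UNIV) (\<lambda>\<omega> j. S j \<omega>)"
    using S_seq by (rule prob_space_distr)
  have "distr M (\<Pi>\<^sub>M j\<in>UNIV. borel) (\<lambda>\<omega> j. U j \<omega>) \<Otimes>\<^sub>M distr M (\<Pi>\<^sub>M j\<in>UNIV. count_space UNIV) (\<lambda>\<omega> j. S j \<omega>)
      = distr M ((\<Pi>\<^sub>M j\<in>UNIV. borel) \<Otimes>\<^sub>M (\<Pi>\<^sub>M j\<in>UNIV. count_space UNIV)) (\<lambda>\<omega>. (\<lambda>j. U j \<omega>, \<lambda>j. S j \<omega>))"
    (is "?DU \<Otimes>\<^sub>M ?DS = ?D")
  proof (rule pair_measure_eqI)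
    show "sigma_finite_measure ?DU" "sigma_finite_measure ?DS" by unfold_locales
    show "sets (?DU \<Otimes>\<^sub>M ?DS) = sets ?D"
      by (simp cong: sets_pair_measure_cong)
    fix A B assume "A \<in> sets ?DU" "B \<in> sets ?DS"
    then have A [measurable]: "A \<in> sets (\<Pi>\<^sub>M j\<in>UNIV. borel)" and B [measurable]: "B \<in> sets (\<Pi>\<^sub>M j\<in>UNIV. count_space UNIV)"
      by auto
    let ?a = "(\<lambda>\<omega> j. U j \<omega>) -` A \<inter> space M" and ?b = "(\<lambda>\<omega> j. S j \<omega>) -` B \<inter> space M"
    have "measure M (?a \<inter> ?b) = measure M ?a * measure M ?b"
      using US by (rule indep_setD) (auto intro!: in_vimage_algebra A B)
    moreover have "(\<lambda>\<omega>. (\<lambda>j. U j \<omega>, \<lambda>j. S j \<omega>)) -` (A \<times> B) \<inter> space M = ?a \<inter> ?b"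
      by auto
    ultimately show "emeasure ?DU A * emeasure ?DS B = emeasure ?D (A \<times> B)"
      using U_seq S_seq measurable_Pair[OF U_seq S_seq]
      by (simp add: emeasure_distr emeasure_eq_measure ennreal_mult')
  qed
  then show "distr M ((\<Pi>\<^sub>M j\<in>UNIV. borel) \<Otimes>\<^sub>M (\<Pi>\<^sub>M j\<in>UNIV. count_space UNIV)) (\<lambda>\<omega>. (\<lambda>j. U j \<omega>, \<lambda>j. S j \<omega>)) = driving_law p"
    unfolding driving_law_def U_distr S_distr by simp
qed


section \<open>The integral equation determines the characteristic function\<close>

definition mass_char :: "real \<Rightarrow> real \<Rightarrow> real \<Rightarrow> real \<Rightarrow> real \<Rightarrow> complex" where
  "mass_char p x t l r = (\<integral>\<omega>. iexp (t * mass_below (fst \<omega>) (snd \<omega>) x l r) \<partial>driving_law p)"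

lemma measurable_driving_components [measurable]:
  "(\<lambda>\<omega>. fst \<omega> j) \<in> borel_measurable (driving_law p)"
  "(\<lambda>\<omega>. snd \<omega> j) \<in> measurable (driving_law p) (count_space UNIV)"
  by measurable

lemma norm_mass_char_le: "norm (mass_char p x t l r) \<le> 1"
proof -
  interpret prob_space "driving_law p" by (rule prob_space_driving_law)
  show ?thesis unfolding mass_char_def
    by (intro norm_integral_le_bound) (auto simp del: of_real_mult)
qed

lemma measurable_mass_char [measurable (raw)]:
  assumes [measurable]: "l \<in> borel_measurable N" "r \<in> borel_measurable N"
  shows "(\<lambda>z. mass_char p x t (l z) (r z)) \<in> borel_measurable N"
proof -
  interpret prob_space "driving_law p" by (rule prob_space_driving_law)
  show ?thesis unfolding mass_char_def by measurable
qed

text \<open>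
  The first cut misses the interval with probability \<open>1 - (l + r)\<close> and then changes nothing; this
  contribution is moved to the left-hand side. In the other cases the cut shortens one side of the
  interval by a uniform amount \<open>v\<close>, and the part cut off contributes \<open>v\<close> to the mass with
  probability \<open>p\<close> on the left and \<open>1 - p\<close> on the right.
\<close>

lemma mass_char_one_step:
  assumes p: "0 \<le> p" "p \<le> 1" and l: "0 \<le> l" "l \<le> x" and r: "0 \<le> r" "x + r \<le> 1"
  shows "(l + r) *\<^sub>R mass_char p x t l r =
    (LINT v:{0..l}|lborel. (p *\<^sub>R iexp (t * v) + of_real (1 - p)) * mass_char p x t (l - v) r) +
    (LINT v:{0..r}|lborel. ((1 - p) *\<^sub>R iexp (t * v) + of_real p) * mass_char p x t l (r - v))"
proof -
  define R where "R = mass_char p x t l r"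
  define H1 where "H1 v = (p *\<^sub>R iexp (t * (v - (x - l))) + of_real (1 - p)) * mass_char p x t (x - v) r" for v
  define H2 where "H2 v = ((1 - p) *\<^sub>R iexp (t * (x + r - v)) + of_real p) * mass_char p x t l (v - x)" for v
  have [measurable]: "H1 \<in> borel_measurable borel" "H2 \<in> borel_measurable borel"
    unfolding H1_def[abs_def] H2_def[abs_def] by measurable
  have coeff: "norm (q *\<^sub>R iexp a + of_real (1 - q)) \<le> 1" if "0 \<le> q" "q \<le> 1" for q a
    using norm_triangle_ineq[of "q *\<^sub>R iexp a" "of_real (1 - q)"] that
    by (simp del: of_real_diff)
  have H_bound: "norm (H1 v) \<le> 1" "norm (H2 v) \<le> 1" for v
    using coeff[of p] coeff[of "1 - p"] p
    by (auto simp: H1_def H2_def norm_mult simp del: of_real_diff of_real_mult intro!: mult_le_one norm_mass_char_le)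
  have step: "p *\<^sub>R (\<integral>\<omega>. iexp (t * mass_below (case_nat v (fst \<omega>)) (case_nat Plus (snd \<omega>)) x l r) \<partial>driving_law p)
        + (1 - p) *\<^sub>R (\<integral>\<omega>. iexp (t * mass_below (case_nat v (fst \<omega>)) (case_nat Minus (snd \<omega>)) x l r) \<partial>driving_law p)
     = R + indicator {x - l<..x} v *\<^sub>R (H1 v - R) + indicator {x<..<x + r} v *\<^sub>R (H2 v - R)" for v
  proof -
    consider "x - l < v \<and> v \<le> x" | "x < v \<and> v < x + r" | "\<not> (x - l < v \<and> v \<le> x)" "\<not> (x < v \<and> v < x + r)"
      by blast
    then show ?thesis
    proof cases
      case 1
      then show ?thesis
        using l(1) r(1)
        by (simp add: mass_below_case_nat H1_def mass_char_def[of p x t "x - v"] ring_distribs exp_add scaleR_conv_of_real del: of_real_mult)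
    next
      case 2
      then show ?thesis
        using l(1) r(1)
        by (simp add: mass_below_case_nat H2_def mass_char_def[of p x t l "v - x"] ring_distribs exp_add scaleR_conv_of_real del: of_real_mult)
    next
      case 3
      then show ?thesis
        using l(1) r(1)
        by (auto simp: mass_below_case_nat R_def mass_char_def scaleR_conv_of_real ring_distribs simp del: of_real_mult)
    qed
  qed
  let ?g = "\<lambda>v. R + indicator {x - l<..x} v *\<^sub>R (H1 v - R) + indicator {x<..<x + r} v *\<^sub>R (H2 v - R)"
  have int: "integrable lborel (\<lambda>v. indicator A v *\<^sub>R f v)"
    if "f \<in> borel_measurable borel" "\<And>v. norm (f v) \<le> 2" "A \<in> sets borel" "A \<subseteq> {0..1}" for A and f :: "real \<Rightarrow> complex"
  proof (rule integrableI_bounded_set[where A = "{0..1}" and B = 2])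
    show "AE v in lborel. v \<notin> {0..1} \<longrightarrow> indicator A v *\<^sub>R f v = 0"
      by (intro AE_I2) (use that(4) in \<open>auto simp: indicator_def\<close>)
  qed (use that in \<open>auto simp: indicator_def\<close>)
  have R_bound: "norm R \<le> 1" by (simp add: R_def norm_mass_char_le)
  have sub: "{x - l<..x} \<subseteq> {0..1}" "{x<..<x + r} \<subseteq> {0..1}" using l r by auto
  have "R = (\<integral>v. ?g v \<partial>cut_law)"
    unfolding step[symmetric]
    unfolding R_def mass_char_def
    by (subst integral_driving_law_iter[OF p, where C = 1]) (auto simp del: of_real_mult)
  \<comment> \<open>separating \<open>R\<close> from \<open>H1\<close> and \<open>H2\<close> produces the terms \<open>- l R\<close> and \<open>- r R\<close>\<close>
  also have "\<dots> = (\<integral>v. indicator {0..1} v *\<^sub>R R + indicator {x - l<..x} v *\<^sub>R H1 v - indicator {x - l<..x} v *\<^sub>R R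
      + indicator {x<..<x + r} v *\<^sub>R H2 v - indicator {x<..<x + r} v *\<^sub>R R \<partial>lborel)"
    unfolding set_lebesgue_integral_def using l r
    by (subst integral_cut_law)
       (auto simp: set_lebesgue_integral_def indicator_def algebra_simps intro!: Bochner_Integration.integral_cong)
  also have "\<dots> = R + (\<integral>v. indicator {x - l<..x} v *\<^sub>R H1 v \<partial>lborel) - l *\<^sub>R R
      + (\<integral>v. indicator {x<..<x + r} v *\<^sub>R H2 v \<partial>lborel) - r *\<^sub>R R"
  proof -
    have "norm (H1 v) \<le> 2" "norm (H2 v) \<le> 2" "norm R \<le> 2" for v
      using H_bound[of v] R_bound by auto
    then show ?thesis
      using sub l r by (simp add: int)
  qed
  also have "(\<integral>v. indicator {x - l<..x} v *\<^sub>R H1 v \<partial>lborel) =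
      (LINT v:{0..l}|lborel. (p *\<^sub>R iexp (t * v) + of_real (1 - p)) * mass_char p x t (l - v) r)"
  proof -
    have "(\<integral>v. indicator {x - l<..x} v *\<^sub>R H1 v \<partial>lborel) =
        (\<integral>v. indicator {x - l<..x} (x - l + v) *\<^sub>R H1 (x - l + v) \<partial>lborel)"
      by (subst lborel_integral_real_affine[where c = 1 and t = "x - l"]) auto
    also have "\<dots> = (LINT v:{0..l}|lborel. (p *\<^sub>R iexp (t * v) + of_real (1 - p)) * mass_char p x t (l - v) r)"
      unfolding set_lebesgue_integral_def
    proof (rule integral_cong_AE)
      show "AE v in lborel. indicator {x - l<..x} (x - l + v) *\<^sub>R H1 (x - l + v) =
          indicator {0..l} v *\<^sub>R ((p *\<^sub>R iexp (t * v) + of_real (1 - p)) * mass_char p x t (l - v) r)"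
        using AE_lborel_singleton[of "0::real"]
        by eventually_elim (auto simp: indicator_def H1_def)
    qed measurable
    finally show ?thesis .
  qed
  also have "(\<integral>v. indicator {x<..<x + r} v *\<^sub>R H2 v \<partial>lborel) =
      (LINT v:{0..r}|lborel. ((1 - p) *\<^sub>R iexp (t * v) + of_real p) * mass_char p x t l (r - v))"
  proof -
    have "(\<integral>v. indicator {x<..<x + r} v *\<^sub>R H2 v \<partial>lborel) =
        (\<integral>v. indicator {x<..<x + r} (x + r + (-1) * v) *\<^sub>R H2 (x + r + (-1) * v) \<partial>lborel)"
      by (subst lborel_integral_real_affine[where c = "-1" and t = "x + r"]) auto
    also have "\<dots> = (LINT v:{0..r}|lborel. ((1 - p) *\<^sub>R iexp (t * v) + of_real p) * mass_char p x t l (r - v))"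
      unfolding set_lebesgue_integral_def
    proof (rule integral_cong_AE)
      show "AE v in lborel. indicator {x<..<x + r} (x + r + (-1) * v) *\<^sub>R H2 (x + r + (-1) * v) =
          indicator {0..r} v *\<^sub>R (((1 - p) *\<^sub>R iexp (t * v) + of_real p) * mass_char p x t l (r - v))"
        using AE_lborel_singleton[of "0::real"] AE_lborel_singleton[of r]
        by eventually_elim (auto simp: indicator_def H2_def)
    qed measurable
    finally show ?thesis .
  qed
  finally show ?thesis
    by (simp add: R_def scaleR_add_left algebra_simps)
qed

text \<open>
  If \<open>d(l, r) \<le> K (l + r)\<close> throughout, then the right-hand side of the inequality is at most
  \<open>K (l\<^sup>2/2 + 2 l r + r\<^sup>2/2) \<le> (3/4) K (l + r)\<^sup>2\<close>, so the bound improves to \<open>(3/4) K (l + r)\<close>.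
  Iteration gives \<open>0\<close>. A linear bound to start from is essential: nonzero constants
  satisfy the inequality with equality.
\<close>

lemma triangular_integral_inequality_imp_zero:
  fixes d :: "real \<Rightarrow> real \<Rightarrow> real"
  assumes nonneg: "\<And>l r. 0 \<le> d l r"
    and linear: "\<And>l r. \<lbrakk>0 \<le> l; l \<le> a; 0 \<le> r; r \<le> b\<rbrakk> \<Longrightarrow> d l r \<le> C * (l + r)"
    and ineq: "\<And>l r. \<lbrakk>0 \<le> l; l \<le> a; 0 \<le> r; r \<le> b\<rbrakk> \<Longrightarrow>
       (l + r) * d l r \<le> (LINT v:{0..l}|lborel. d (l - v) r) + (LINT v:{0..r}|lborel. d l (r - v))"
    and lr: "0 \<le> l" "l \<le> a" "0 \<le> r" "r \<le> b"
  shows "d l r = 0"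
proof -
  have geometric: "d l r \<le> C * (3/4) ^ n * (l + r)" if "0 \<le> l" "l \<le> a" "0 \<le> r" "r \<le> b" for n l r
    using that
  proof (induction n arbitrary: l r)
    case 0
    then show ?case using linear by simp
  next
    case (Suc n)
    define K where "K = C * (3/4) ^ n"
    show ?case
    proof (cases "l + r = 0")
      case True
      then show ?thesis using linear[of l r] Suc.prems by simp
    next
      case False
      then have pos: "0 < l + r" using Suc.prems by simp
      have K: "0 \<le> K"
      proof -
        have "0 \<le> K * (l + r)"
          using order_trans[OF nonneg Suc.IH[OF Suc.prems]] by (simp add: K_def)
        then show ?thesis using pos by (simp add: zero_le_mult_iff)
      qed
      have lin_int: "(LINT v:{0..s}|lborel. K * (s - v + c)) = K * (s\<^sup>2 / 2 + s * c)"
        and lin_integrable: "integrable lborel (\<lambda>v. indicator {0..s} v *\<^sub>R (K * (s - v + c)))" if "0 \<le> s" for s c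
      proof -
        have "has_bochner_integral lborel (\<lambda>v. indicator {0..s} v *\<^sub>R (K * (s - v + c)))
            (K * (s * s - s\<^sup>2 / 2 + c * s) - K * (s * 0 - 0\<^sup>2 / 2 + c * 0))"
        proof (rule has_bochner_integral_FTC_Icc)
          show "((\<lambda>v. K * (s * v - v\<^sup>2 / 2 + c * v)) has_vector_derivative K * (s - v + c)) (at v within {0..s})" for v
            by (auto intro!: derivative_eq_intros simp: has_real_derivative_iff_has_vector_derivative[symmetric])
        qed (use that in \<open>auto intro!: continuous_intros\<close>)
        then show "(LINT v:{0..s}|lborel. K * (s - v + c)) = K * (s\<^sup>2 / 2 + s * c)"
          and "integrable lborel (\<lambda>v. indicator {0..s} v *\<^sub>R (K * (s - v + c)))"
          by (auto simp: set_lebesgue_integral_def has_bochner_integral_iff power2_eq_square field_simps)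
      qed
      have left: "(LINT v:{0..l}|lborel. d (l - v) r) \<le> K * (l\<^sup>2 / 2 + l * r)"
      proof -
        have "(LINT v:{0..l}|lborel. d (l - v) r) \<le> (LINT v:{0..l}|lborel. K * (l - v + r))"
          unfolding set_lebesgue_integral_def
        proof (rule integral_mono')
          show "indicator {0..l} v *\<^sub>R d (l - v) r \<le> indicator {0..l} v *\<^sub>R (K * (l - v + r))" for v
            using Suc.IH[of "l - v" r] Suc.prems by (auto simp: indicator_def K_def)
          show "0 \<le> indicator {0..l} v *\<^sub>R (K * (l - v + r))" for v
            using K Suc.prems by (auto simp: indicator_def)
        qed (use lin_integrable Suc.prems in auto)
        also have "\<dots> = K * (l\<^sup>2 / 2 + l * r)"
          using Suc.prems by (intro lin_int)
        finally show ?thesis .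
      qed
      have right: "(LINT v:{0..r}|lborel. d l (r - v)) \<le> K * (r\<^sup>2 / 2 + r * l)"
      proof -
        have "(LINT v:{0..r}|lborel. d l (r - v)) \<le> (LINT v:{0..r}|lborel. K * (r - v + l))"
          unfolding set_lebesgue_integral_def
        proof (rule integral_mono')
          show "indicator {0..r} v *\<^sub>R d l (r - v) \<le> indicator {0..r} v *\<^sub>R (K * (r - v + l))" for v
            using Suc.IH[of l "r - v"] Suc.prems by (auto simp: indicator_def K_def add.commute)
          show "0 \<le> indicator {0..r} v *\<^sub>R (K * (r - v + l))" for v
            using K Suc.prems by (auto simp: indicator_def)
        qed (use lin_integrable Suc.prems in auto)
        also have "\<dots> = K * (r\<^sup>2 / 2 + r * l)"
          using Suc.prems by (intro lin_int)
        finally show ?thesis .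
      qed
      have "(l + r) * d l r \<le> K * (l\<^sup>2 / 2 + l * r) + K * (r\<^sup>2 / 2 + r * l)"
        using ineq[of l r] left right Suc.prems by linarith
      also have "\<dots> = (l + r) * (3/4 * K * (l + r)) - K * ((l - r)\<^sup>2 / 4)"
        by (simp add: power2_eq_square field_simps)
      also have "\<dots> \<le> (l + r) * (3/4 * K * (l + r))"
        using K by simp
      finally have "d l r \<le> 3/4 * K * (l + r)"
        using pos by (rule mult_left_le_imp_le)
      then show ?thesis by (simp add: K_def)
    qed
  qed
  have "(\<lambda>n. C * (3/4) ^ n * (l + r)) \<longlonglongrightarrow> C * 0 * (l + r)"
    by (intro tendsto_intros LIMSEQ_power_zero) auto
  then have "d l r \<le> 0"
    using geometric[OF lr] by (intro LIMSEQ_le_const[of _ 0]) auto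
  then show ?thesis using nonneg[of l r] by simp
qed

lemma norm_iexp_minus_one_le: "norm (iexp a - 1) \<le> \<bar>a\<bar>"
  using iexp_approx1[of a 0] by simp

text \<open>
  Together with \<open>norm_arcsine_char_minus_one_le\<close>, the linear bound from which the contraction starts.
\<close>

lemma norm_mass_char_minus_one_le:
  assumes "0 \<le> l" "0 \<le> r"
  shows "norm (mass_char p x t l r - 1) \<le> \<bar>t\<bar> * (l + r)"
proof -
  interpret prob_space "driving_law p" by (rule prob_space_driving_law)
  have "integrable (driving_law p) (\<lambda>\<omega>. iexp (t * mass_below (fst \<omega>) (snd \<omega>) x l r))"
    by (intro integrable_bounded[where C = 1]) (auto simp del: of_real_mult)
  then have "mass_char p x t l r - 1 = (\<integral>\<omega>. iexp (t * mass_below (fst \<omega>) (snd \<omega>) x l r) - 1 \<partial>driving_law p)"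
    by (simp add: mass_char_def prob_space del: of_real_mult)
  also have "norm \<dots> \<le> \<bar>t\<bar> * (l + r)"
  proof (rule norm_integral_le_bound)
    fix \<omega> :: "(nat \<Rightarrow> real) \<times> (nat \<Rightarrow> sign)"
    let ?m = "mass_below (fst \<omega>) (snd \<omega>) x l r"
    have "norm (iexp (t * ?m) - 1) \<le> \<bar>t\<bar> * ?m"
      using norm_iexp_minus_one_le[of "t * ?m"] mass_below_nonneg[of "fst \<omega>" "snd \<omega>" x l r]
      by (simp add: abs_mult del: of_real_mult)
    also have "\<dots> \<le> \<bar>t\<bar> * (l + r)"
      using mass_below_le[OF assms] by (intro mult_left_mono) auto
    finally show "norm (iexp (t * ?m) - 1) \<le> \<bar>t\<bar> * (l + r)" .
  qed
  finally show ?thesis .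
qed

lemma norm_arcsine_char_minus_one_le:
  assumes p: "0 < p" "p < 1"
  shows "norm (char (arcsine_law p) s - 1) \<le> \<bar>s\<bar>"
proof -
  interpret W: real_distribution "arcsine_law p" using p by (rule real_distribution_arcsine_law)
  have int: "integrable (arcsine_law p) (\<lambda>w. iexp (s * w))"
    by (intro W.integrable_const_bound[where B = 1]) (auto simp del: of_real_mult)
  then have "char (arcsine_law p) s - 1 = (\<integral>w. iexp (s * w) - 1 \<partial>arcsine_law p)"
    using W.prob_space by (simp add: char_def del: of_real_mult)
  also have "norm \<dots> \<le> (\<integral>w. norm (iexp (s * w) - 1) \<partial>arcsine_law p)"
    by (rule integral_norm_bound)
  also have "\<dots> \<le> \<bar>s\<bar>"
  proof (rule W.integral_le_const)
    show "integrable (arcsine_law p) (\<lambda>w. norm (iexp (s * w) - 1))"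
      using int by auto
    show "AE w in arcsine_law p. norm (iexp (s * w) - 1) \<le> \<bar>s\<bar>"
      using AE_arcsine_law[of p]
    proof eventually_elim
      case (elim w)
      have "norm (iexp (s * w) - 1) \<le> \<bar>s\<bar> * \<bar>w\<bar>"
        using norm_iexp_minus_one_le[of "s * w"] by (simp add: abs_mult)
      also have "\<dots> \<le> \<bar>s\<bar> * 1" using elim by (intro mult_left_mono) auto
      finally show ?case by simp
    qed
  qed
  finally show ?thesis .
qed

text \<open>
  Both sides solve the same integral equation and are \<open>1 + O(l + r)\<close>, so the norm of their
  difference satisfies the hypotheses of \<open>triangular_integral_inequality_imp_zero\<close>.
\<close>

lemma mass_char_eq:
  assumes p: "0 < p" "p < 1" and l: "0 \<le> l" "l \<le> x" and r: "0 \<le> r" "x + r \<le> 1"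
  shows "mass_char p x t l r = char (arcsine_law p) (t * l) * char (arcsine_law (1 - p)) (t * r)"
proof -
  have q: "0 < 1 - p" "1 - p < 1" using p by auto
  interpret P: real_distribution "arcsine_law p" using p by (rule real_distribution_arcsine_law)
  interpret Q: real_distribution "arcsine_law (1 - p)" using q by (rule real_distribution_arcsine_law)
  define h where "h l r = char (arcsine_law p) (t * l) * char (arcsine_law (1 - p)) (t * r)" for l r
  define c1 where "c1 v = p *\<^sub>R iexp (t * v) + of_real (1 - p)" for v
  define c2 where "c2 v = (1 - p) *\<^sub>R iexp (t * v) + of_real p" for v
  define d where "d l r = norm (mass_char p x t l r - h l r)" for l r
  have coeff: "norm (c1 v) \<le> 1" "norm (c2 v) \<le> 1" for v
    using norm_triangle_ineq[of "p *\<^sub>R iexp (t * v)" "of_real (1 - p)"]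
      norm_triangle_ineq[of "(1 - p) *\<^sub>R iexp (t * v)" "of_real p"] p
    by (simp_all add: c1_def c2_def del: of_real_diff of_real_mult)
  have h_le: "norm (h l r) \<le> 1" for l r
    by (auto simp: h_def norm_mult intro!: mult_le_one P.cmod_char_le_1 Q.cmod_char_le_1)
  have [measurable]: "c1 \<in> borel_measurable borel" "c2 \<in> borel_measurable borel"
    unfolding c1_def[abs_def] c2_def[abs_def] by measurable
  have h_meas [measurable]: "(\<lambda>v. h (f v) (g v)) \<in> borel_measurable borel"
    if [measurable]: "f \<in> borel_measurable borel" "g \<in> borel_measurable borel" for f g
    unfolding h_def by measurable
  have integrable: "set_integrable lborel {0..s} f"
    if "f \<in> borel_measurable borel" "\<And>v. norm (f v) \<le> 1" for s and f :: "real \<Rightarrow> complex"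
    unfolding set_integrable_def
    by (rule integrableI_bounded_set[where A = "{0..s}" and B = 1])
       (use that in \<open>auto simp: indicator_def emeasure_lborel_Icc_eq\<close>)
  have diff: "norm ((LINT v:{0..s}|lborel. c v * f v) - (LINT v:{0..s}|lborel. c v * g v)) \<le> (LINT v:{0..s}|lborel. norm (f v - g v))"
    if [measurable]: "c \<in> borel_measurable borel" "f \<in> borel_measurable borel" "g \<in> borel_measurable borel"
      and le: "\<And>v. norm (c v) \<le> 1" "\<And>v. norm (f v) \<le> 1" "\<And>v. norm (g v) \<le> 1"
    for s and c f g :: "real \<Rightarrow> complex"
  proof -
    have cf: "set_integrable lborel {0..s} (\<lambda>v. c v * f v)" and cg: "set_integrable lborel {0..s} (\<lambda>v. c v * g v)"
      using le by (auto intro!: integrable mult_le_one simp: norm_mult)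
    have fg: "set_integrable lborel {0..s} (\<lambda>v. f v - g v)"
      using le by (intro set_integral_diff(1) integrable) auto
    have "(LINT v:{0..s}|lborel. c v * f v) - (LINT v:{0..s}|lborel. c v * g v) = (LINT v:{0..s}|lborel. c v * f v - c v * g v)"
      using cf cg by (rule set_integral_diff(2)[symmetric])
    also have "norm \<dots> \<le> (LINT v:{0..s}|lborel. norm (c v * f v - c v * g v))"
      using cf cg by (intro set_integral_norm_bound set_integral_diff(1))
    also have "\<dots> \<le> (LINT v:{0..s}|lborel. norm (f v - g v))"
    proof (rule set_integral_mono)
      show "norm (c v * f v - c v * g v) \<le> norm (f v - g v)" for v
        using mult_right_mono[OF le(1)[of v] norm_ge_zero[of "f v - g v"]]
        by (simp add: norm_mult flip: right_diff_distrib)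
    qed (use cf cg fg in \<open>auto intro!: set_integrable_norm set_integral_diff(1)\<close>)
    finally show ?thesis .
  qed
  have h_step: "(l + r) *\<^sub>R h l r = (LINT v:{0..l}|lborel. c1 v * h (l - v) r) + (LINT v:{0..r}|lborel. c2 v * h l (r - v))"
    if "0 \<le> l" "0 \<le> r" for l r
  proof -
    have "(LINT v:{0..l}|lborel. c1 v * h (l - v) r) = l *\<^sub>R char (arcsine_law p) (t * l) * char (arcsine_law (1 - p)) (t * r)"
      using arcsine_char_integral_equation[OF p \<open>0 \<le> l\<close>, of t]
      by (simp add: h_def c1_def set_lebesgue_integral_def mult.assoc[symmetric] flip: integral_mult_left_zero)
    moreover have "(LINT v:{0..r}|lborel. c2 v * h l (r - v)) = char (arcsine_law p) (t * l) * r *\<^sub>R char (arcsine_law (1 - p)) (t * r)"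
      using arcsine_char_integral_equation[OF q \<open>0 \<le> r\<close>, of t]
      by (simp add: h_def c2_def set_lebesgue_integral_def mult.left_commute flip: integral_mult_right_zero)
    ultimately show ?thesis by (simp add: h_def scaleR_add_left)
  qed
  have R_step: "(l + r) *\<^sub>R mass_char p x t l r =
      (LINT v:{0..l}|lborel. c1 v * mass_char p x t (l - v) r) + (LINT v:{0..r}|lborel. c2 v * mass_char p x t l (r - v))"
    if "0 \<le> l" "l \<le> x" "0 \<le> r" "r \<le> 1 - x" for l r
    unfolding c1_def c2_def using p that by (intro mass_char_one_step) auto
  have "d l r = 0"
  proof (rule triangular_integral_inequality_imp_zero[where d = d and l = l and r = r and a = x and b = "1 - x" and C = "2 * \<bar>t\<bar>"])
    fix l r :: real assume lr: "0 \<le> l" "l \<le> x" "0 \<le> r" "r \<le> 1 - x"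
    show "d l r \<le> 2 * \<bar>t\<bar> * (l + r)"
    proof -
      let ?A = "char (arcsine_law p) (t * l)" and ?B = "char (arcsine_law (1 - p)) (t * r)"
      have "h l r - 1 = (?A - 1) * ?B + (?B - 1)" by (simp add: h_def algebra_simps)
      then have "norm (h l r - 1) \<le> norm (?A - 1) * norm ?B + norm (?B - 1)"
        by (metis norm_mult norm_triangle_ineq)
      also have "\<dots> \<le> norm (?A - 1) * 1 + norm (?B - 1)"
        by (intro add_mono mult_left_mono Q.cmod_char_le_1) auto
      also have "\<dots> \<le> \<bar>t\<bar> * (l + r)"
        using norm_arcsine_char_minus_one_le[OF p, of "t * l"] norm_arcsine_char_minus_one_le[OF q, of "t * r"] lr
        by (simp add: abs_mult ring_distribs)
      finally have "norm (h l r - 1) \<le> \<bar>t\<bar> * (l + r)" .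
      then show ?thesis
        using norm_mass_char_minus_one_le[of l r p x t] lr
          norm_triangle_ineq4[of "mass_char p x t l r - 1" "h l r - 1"]
        by (simp add: d_def)
    qed
    have diff1: "norm ((LINT v:{0..l}|lborel. c1 v * mass_char p x t (l - v) r) - (LINT v:{0..l}|lborel. c1 v * h (l - v) r))
        \<le> (LINT v:{0..l}|lborel. d (l - v) r)"
      unfolding d_def by (intro diff coeff norm_mass_char_le h_le) measurable
    have diff2: "norm ((LINT v:{0..r}|lborel. c2 v * mass_char p x t l (r - v)) - (LINT v:{0..r}|lborel. c2 v * h l (r - v)))
        \<le> (LINT v:{0..r}|lborel. d l (r - v))"
      unfolding d_def by (intro diff coeff norm_mass_char_le h_le) measurable
    have "(l + r) * d l r = norm ((l + r) *\<^sub>R mass_char p x t l r - (l + r) *\<^sub>R h l r)"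
      using lr by (simp add: d_def flip: scaleR_diff_right)
    also have "\<dots> \<le> (LINT v:{0..l}|lborel. d (l - v) r) + (LINT v:{0..r}|lborel. d l (r - v))"
      unfolding R_step[OF lr] h_step[OF lr(1,3)]
      using norm_triangle_mono[OF diff1 diff2] by (simp add: algebra_simps)
    finally show "(l + r) * d l r \<le> (LINT v:{0..l}|lborel. d (l - v) r) + (LINT v:{0..r}|lborel. d l (r - v))" .
  qed (use l r in \<open>auto simp: d_def\<close>)
  then show ?thesis by (simp add: d_def h_def)
qed

section \<open>The law of \<open>\<phi>(x)\<close> for fixed \<open>x\<close>\<close>

lemma distr_arcsine_law_scale:
  assumes p: "0 < p" "p < 1" and l: "0 < l"
  shows "distr (arcsine_law p) borel (\<lambda>w. l * w) = density lborel (\<lambda>z. ennreal (arcsine_density p l z))"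
proof (rule measure_eqI)
  fix A assume "A \<in> sets (distr (arcsine_law p) borel (\<lambda>w. l * w))"
  then have [measurable]: "A \<in> sets borel" by simp
  have scale: "l * arcsine_density p l (l * w) = arcsine_density p 1 w" for w
  proof (cases "w \<in> {0..1}")
    case True
    have "(l * w) powr (1 - p) * (l - l * w) powr p = l powr (1 - p) * l powr p * (w powr (1 - p) * (1 - w) powr p)"
      using True l powr_mult[of l w "1 - p"] powr_mult[of l "1 - w" p] by (simp add: algebra_simps)
    also have "l powr (1 - p) * l powr p = l" using l by (simp flip: powr_add)
    finally show ?thesis using True l by (simp add: arcsine_density_def mult_le_cancel_left_pos)
  next
    case False
    then have "l * w \<notin> {0..l}" using l by (auto simp: zero_le_mult_iff)
    with False show ?thesis by (auto simp: arcsine_density_def)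
  qed
  have "emeasure (distr (arcsine_law p) borel (\<lambda>w. l * w)) A = (\<integral>\<^sup>+w. ennreal (arcsine_density p 1 w) * indicator A (l * w) \<partial>lborel)"
    by (subst nn_integral_indicator[symmetric], simp, subst nn_integral_distr)
       (auto simp: arcsine_law_def nn_integral_density)
  also have "\<dots> = ennreal l * (\<integral>\<^sup>+w. ennreal (arcsine_density p l (0 + l * w)) * indicator A (0 + l * w) \<partial>lborel)"
    using l arcsine_density_nonneg[OF p]
    by (subst nn_integral_cmult[symmetric]) (auto simp: scale[symmetric] ennreal_mult' mult.assoc)
  also have "\<dots> = (\<integral>\<^sup>+z. ennreal (arcsine_density p l z) * indicator A z \<partial>lborel)"
    using l by (subst (2) nn_integral_real_affine[where c = l and t = 0]) auto
  also have "\<dots> = emeasure (density lborel (\<lambda>z. ennreal (arcsine_density p l z))) A"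
    by (subst emeasure_density) auto
  finally show "emeasure (distr (arcsine_law p) borel (\<lambda>w. l * w)) A = emeasure (density lborel (\<lambda>z. ennreal (arcsine_density p l z))) A" .
qed simp

lemma char_distr_scale:
  assumes [measurable_cong]: "sets M = sets borel"
  shows "char (distr M borel (\<lambda>w. l * w)) t = char M (t * l)"
  unfolding char_def by (subst integral_distr) (auto simp: mult.assoc)

lemma char_convolution:
  assumes "real_distribution M" "real_distribution N"
  shows "char (M \<star> N) t = char M t * char N t"
proof -
  interpret M: real_distribution M by fact
  interpret N: real_distribution N by fact
  interpret MN: pair_prob_space M N by unfold_locales
  have "char (M \<star> N) t = (\<integral>z. iexp (t * (fst z + snd z)) \<partial>(M \<Otimes>\<^sub>M N))"
    unfolding char_def convolution_def by (subst integral_distr) (auto simp: case_prod_beta)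
  also have "\<dots> = (\<integral>x. (\<integral>y. iexp (t * (x + y)) \<partial>N) \<partial>M)"
    by (subst MN.integral_fst'[symmetric])
       (auto intro!: MN.integrable_bounded[where C = 1] simp del: of_real_mult of_real_add)
  also have "\<dots> = (\<integral>x. iexp (t * x) * char N t \<partial>M)"
    by (simp add: char_def ring_distribs exp_add)
  also have "\<dots> = char M t * char N t"
    by (simp add: char_def)
  finally show ?thesis .
qed

lemma real_distribution_convolution:
  assumes "real_distribution M" "real_distribution N"
  shows "real_distribution (M \<star> N)"
proof -
  interpret M: real_distribution M by fact
  interpret N: real_distribution N by fact
  interpret MN: pair_prob_space M N by unfold_locales
  show ?thesis
    unfolding convolution_def by (intro MN.real_distribution_distr) measurable
qed

text \<open>
  The mass below \<open>x\<close> is the sum of independent contributions from both sides of \<open>x\<close>: its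
  characteristic function factorises by \<open>mass_char_eq\<close>.
\<close>

lemma distr_mass_below:
  assumes p: "0 < p" "p < 1" and x: "0 < x" "x < 1"
  shows "distr (driving_law p) borel (\<lambda>\<omega>. mass_below (fst \<omega>) (snd \<omega>) x x (1 - x)) =
    density lborel (\<lambda>y. \<integral>\<^sup>+z. ennreal (arcsine_density (1 - p) (1 - x) (y - z)) * ennreal (arcsine_density p x z) \<partial>lborel)"
proof -
  have q: "0 < 1 - p" "1 - p < 1" using p by auto
  interpret D: prob_space "driving_law p" by (rule prob_space_driving_law)
  interpret P: real_distribution "arcsine_law p" using p by (rule real_distribution_arcsine_law)
  interpret Q: real_distribution "arcsine_law (1 - p)" using q by (rule real_distribution_arcsine_law)
  let ?M = "distr (driving_law p) borel (\<lambda>\<omega>. mass_below (fst \<omega>) (snd \<omega>) x x (1 - x))"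
  let ?P = "distr (arcsine_law p) borel (\<lambda>w. x * w)" and ?Q = "distr (arcsine_law (1 - p)) borel (\<lambda>w. (1 - x) * w)"
  have PQ: "real_distribution ?P" "real_distribution ?Q"
    by (intro P.real_distribution_distr Q.real_distribution_distr; simp)+
  have "?M = (?Q \<star> ?P)"
  proof (rule Levy_uniqueness)
    show "real_distribution ?M" by (intro D.real_distribution_distr) measurable
    show "real_distribution (?Q \<star> ?P)" using PQ by (intro real_distribution_convolution)
    show "char ?M = char (?Q \<star> ?P)"
    proof
      fix t
      have "char ?M t = mass_char p x t x (1 - x)"
        unfolding char_def mass_char_def by (subst integral_distr) auto
      also have "\<dots> = char ?P t * char ?Q t"
        using p x by (subst mass_char_eq) (auto simp: char_distr_scale)
      finally show "char ?M t = char (?Q \<star> ?P) t"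
        using PQ by (simp add: char_convolution mult.commute)
    qed
  qed
  also have "\<dots> = density lborel (\<lambda>y. \<integral>\<^sup>+z. ennreal (arcsine_density (1 - p) (1 - x) (y - z)) * ennreal (arcsine_density p x z) \<partial>lborel)"
  proof -
    have eqs: "?P = density lborel (\<lambda>z. ennreal (arcsine_density p x z))"
      "?Q = density lborel (\<lambda>z. ennreal (arcsine_density (1 - p) (1 - x) z))"
      using p q x by (intro distr_arcsine_law_scale; simp)+
    have fin: "finite_measure ?P" "finite_measure ?Q"
      using PQ by (auto simp: real_distribution_def prob_space_def)
    show ?thesis
      unfolding eqs by (rule convolution_density) (use fin[unfolded eqs] in auto)
  qed
  finally show ?thesis .
qed

text \<open>
  The indicators of \<open>{0..x}\<close> at \<open>z\<close> and of \<open>{0..1 - x}\<close> at \<open>y - z\<close> multiply to the indicator of the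
  range of integration in \<open>rec_density\<close>.
\<close>

lemma nn_integral_arcsine_densities:
  assumes p: "0 < p" "p < 1" and x: "0 < x" "x < 1"
  shows "(\<integral>\<^sup>+z. ennreal (arcsine_density (1 - p) (1 - x) (y - z)) * ennreal (arcsine_density p x z) \<partial>lborel) = rec_density p (x, y)"
proof -
  let ?c = "1 / ((Gamma p)\<^sup>2 * (Gamma (1 - p))\<^sup>2)"
  let ?g = "\<lambda>z. 1 / (z powr (1 - p) * (x - z) powr p * (y - z) powr p * (1 - x - y + z) powr (1 - p))"
  have "ennreal (arcsine_density (1 - p) (1 - x) (y - z)) * ennreal (arcsine_density p x z)
      = ennreal ?c * (ennreal (?g z) * indicator {max (x + y - 1) 0..min x y} z)" for z
  proof -
    have "arcsine_density (1 - p) (1 - x) (y - z) * arcsine_density p x z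
      = ?c * (?g z * indicator {max (x + y - 1) 0..min x y} z)"
      by (auto simp: arcsine_density_def indicator_def power2_eq_square algebra_simps)
    moreover have "0 \<le> ?c" "0 \<le> ?g z" "0 \<le> arcsine_density (1 - p) (1 - x) (y - z)"
      using p by (auto intro!: arcsine_density_nonneg)
    ultimately show ?thesis
      by (metis ennreal_mult' ennreal_indicator)
  qed
  then have "(\<integral>\<^sup>+z. ennreal (arcsine_density (1 - p) (1 - x) (y - z)) * ennreal (arcsine_density p x z) \<partial>lborel)
     = (\<integral>\<^sup>+z. ennreal ?c * (ennreal (?g z) * indicator {max (x + y - 1) 0..min x y} z) \<partial>lborel)"
    by simp
  also have "\<dots> = rec_density p (x, y)"
    unfolding rec_density_def prod.case by (rule nn_integral_cmult) measurable
  finally show ?thesis .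
qed

lemma measurable_rec_density [measurable]: "rec_density p \<in> borel_measurable (borel \<Otimes>\<^sub>M borel)"
  unfolding rec_density_def indicator_def atLeastAtMost_iff by measurable

section \<open>The intensity measure\<close>

text \<open>
  The two sides differ only in whether the point \<open>1\<close>, a null set, is included.
\<close>

lemma rec_phi_eq_mass_below:
  assumes "0 \<le> x" "x \<le> 1"
  shows "rec_phi u s x = mass_below u s x x (1 - x)"
proof -
  have "rec_phi u s x = measure lborel {y \<in> {0..1}. rec_prec u s y x}"
    unfolding rec_phi_def by (rule measure_restrict_space) auto
  also have "\<dots> = measure lborel {y \<in> {0..<1}. rec_prec u s y x}"
  proof (rule measure_eq_AE)
    show "AE y in lborel. y \<in> {y \<in> {0..1}. rec_prec u s y x} \<longleftrightarrow> y \<in> {y \<in> {0..<1}. rec_prec u s y x}"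
      using AE_lborel_singleton[of "1::real"] by eventually_elim auto
  qed measurable
  finally show ?thesis by (simp add: mass_below_def)
qed

lemma unit_square_borel: "unit_square \<in> sets borel"
  by (intro borel_closed closed_Times closed_atLeastAtMost)

lemma emeasure_rec_permuton:
  assumes A [measurable]: "A \<in> sets borel" and sub: "A \<subseteq> unit_square"
  shows "emeasure (rec_permuton u s) A =
    (\<integral>\<^sup>+x. indicator {0..1} x * indicator A (x, mass_below u s x x (1 - x)) \<partial>lborel)"
proof -
  have "(\<lambda>x. (x, mass_below u s x x (1 - x))) \<in> borel_measurable lborel"
    by measurable
  then have "(\<lambda>x. (x, mass_below u s x x (1 - x))) \<in> measurable Leb (restrict_space borel unit_square)"
    using mass_below_le[of x "1 - x" u s x for x] mass_below_nonneg
    by (intro measurable_restrict_space2 measurable_restrict_space1) (auto simp: space_restrict_space)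
  then have meas: "(\<lambda>x. (x, rec_phi u s x)) \<in> measurable Leb (restrict_space borel unit_square)"
    by (rule measurable_cong[THEN iffD1, rotated]) (simp add: space_restrict_space rec_phi_eq_mass_below)
  have "A \<in> sets (restrict_space borel unit_square)"
    using A sub unit_square_borel by (simp add: sets_restrict_space_iff)
  then have "emeasure (rec_permuton u s) A = (\<integral>\<^sup>+x. indicator A (x, rec_phi u s x) \<partial>Leb)"
    unfolding rec_permuton_def using meas
    by (subst nn_integral_indicator[symmetric], simp, subst nn_integral_distr) auto
  also have "\<dots> = (\<integral>\<^sup>+x. indicator A (x, rec_phi u s x) * indicator {0..1} x \<partial>lborel)"
    by (rule nn_integral_restrict_space) auto
  also have "\<dots> = (\<integral>\<^sup>+x. indicator {0..1} x * indicator A (x, mass_below u s x x (1 - x)) \<partial>lborel)"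
    by (intro nn_integral_cong) (auto simp: indicator_def rec_phi_eq_mass_below)
  finally show ?thesis .
qed

lemma measurable_emeasure_rec_permuton:
  assumes A [measurable]: "A \<in> sets borel" and sub: "A \<subseteq> unit_square"
  shows "(\<lambda>\<omega>. emeasure (rec_permuton (fst \<omega>) (snd \<omega>)) A)
    \<in> borel_measurable ((\<Pi>\<^sub>M j\<in>UNIV. borel) \<Otimes>\<^sub>M (\<Pi>\<^sub>M j\<in>UNIV. count_space UNIV))"
  unfolding emeasure_rec_permuton[OF A sub] by measurable

lemma nn_integral_phi_law:
  assumes p: "0 < p" "p < 1" and x: "0 < x" "x < 1"
    and f [measurable]: "f \<in> borel_measurable borel"
  shows "(\<integral>\<^sup>+\<omega>. f (mass_below (fst \<omega>) (snd \<omega>) x x (1 - x)) \<partial>driving_law p) =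
    (\<integral>\<^sup>+y. rec_density p (x, y) * f y \<partial>lborel)"
proof -
  have "(\<lambda>\<omega>. mass_below (fst \<omega>) (snd \<omega>) x x (1 - x)) \<in> measurable (driving_law p) borel"
    by measurable
  from nn_integral_distr[OF this, of f]
  have "(\<integral>\<^sup>+\<omega>. f (mass_below (fst \<omega>) (snd \<omega>) x x (1 - x)) \<partial>driving_law p) =
      (\<integral>\<^sup>+y. f y \<partial>density lborel (\<lambda>y. rec_density p (x, y)))"
    unfolding distr_mass_below[OF p x] nn_integral_arcsine_densities[OF p x] by simp
  also have "\<dots> = (\<integral>\<^sup>+y. rec_density p (x, y) * f y \<partial>lborel)"
    by (rule nn_integral_density) auto
  finally show ?thesis .
qed

text \<open>
  Exchanging the integrals over the driving sequences and over the abscissa \<open>x\<close> leaves, for each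
  \<open>x\<close>, an integral against the law of \<open>\<phi>(x)\<close>. That law is known for \<open>0 < x < 1\<close>, which is
  almost every relevant \<open>x\<close>.
\<close>

lemma nn_integral_emeasure_rec_permuton:
  assumes p: "0 < p" "p < 1" and A [measurable]: "A \<in> sets borel" and sub: "A \<subseteq> unit_square"
  shows "(\<integral>\<^sup>+\<omega>. emeasure (rec_permuton (fst \<omega>) (snd \<omega>)) A \<partial>driving_law p) =
    (\<integral>\<^sup>+z. rec_density p z * indicator A z \<partial>lborel)"
proof -
  interpret D: prob_space "driving_law p" by (rule prob_space_driving_law)
  interpret LD: pair_sigma_finite lborel "driving_law p" by unfold_locales
  define F where "F x \<omega> = (indicator {0..1} x * indicator A (x, mass_below (fst \<omega>) (snd \<omega>) x x (1 - x)) :: ennreal)"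
    for x :: real and \<omega> :: "(nat \<Rightarrow> real) \<times> (nat \<Rightarrow> sign)"
  have F: "case_prod F \<in> borel_measurable (lborel \<Otimes>\<^sub>M driving_law p)"
    unfolding F_def by measurable
  have A2 [measurable]: "A \<in> sets (borel \<Otimes>\<^sub>M borel)"
    using A by (subst borel_prod)
  have inner: "(\<integral>\<^sup>+\<omega>. F x \<omega> \<partial>driving_law p) = (\<integral>\<^sup>+y. rec_density p (x, y) * indicator A (x, y) \<partial>lborel)"
    if "x \<noteq> 0" "x \<noteq> 1" for x
  proof (cases "0 < x \<and> x < 1")
    case True
    then have "(\<integral>\<^sup>+\<omega>. F x \<omega> \<partial>driving_law p) = (\<integral>\<^sup>+\<omega>. indicator A (x, mass_below (fst \<omega>) (snd \<omega>) x x (1 - x)) \<partial>driving_law p)"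
      by (simp add: F_def)
    also have "\<dots> = (\<integral>\<^sup>+y. rec_density p (x, y) * indicator A (x, y) \<partial>lborel)"
      using True p by (intro nn_integral_phi_law) auto
    finally show ?thesis .
  next
    case False
    then have "F x \<omega> = 0" "indicator A (x, y) = (0 :: ennreal)" for \<omega> y
      using that sub by (auto simp: F_def indicator_def)
    then show ?thesis by simp
  qed
  have "(\<integral>\<^sup>+\<omega>. emeasure (rec_permuton (fst \<omega>) (snd \<omega>)) A \<partial>driving_law p) = (\<integral>\<^sup>+\<omega>. (\<integral>\<^sup>+x. F x \<omega> \<partial>lborel) \<partial>driving_law p)"
    unfolding F_def emeasure_rec_permuton[OF A sub] ..
  also have "\<dots> = (\<integral>\<^sup>+x. (\<integral>\<^sup>+\<omega>. F x \<omega> \<partial>driving_law p) \<partial>lborel)"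
    using F by (rule LD.Fubini')
  also have "\<dots> = (\<integral>\<^sup>+x. (\<integral>\<^sup>+y. rec_density p (x, y) * indicator A (x, y) \<partial>lborel) \<partial>lborel)"
  proof (rule nn_integral_cong_AE)
    show "AE x in lborel. (\<integral>\<^sup>+\<omega>. F x \<omega> \<partial>driving_law p) = (\<integral>\<^sup>+y. rec_density p (x, y) * indicator A (x, y) \<partial>lborel)"
      using AE_lborel_singleton[of "0::real"] AE_lborel_singleton[of "1::real"]
      by eventually_elim (rule inner)
  qed
  also have "\<dots> = (\<integral>\<^sup>+z. rec_density p z * indicator A z \<partial>(lborel \<Otimes>\<^sub>M lborel))"
    by (rule lborel.nn_integral_fst) measurable
  finally show ?thesis by (simp only: lborel_prod)
qed

theorem corollary1p10:
  fixes M :: "'a measure" and p :: real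
    and U :: "nat \<Rightarrow> 'a \<Rightarrow> real" and S :: "nat \<Rightarrow> 'a \<Rightarrow> sign"
  assumes "0 < p" and "p < 1"
    and "prob_space M"
    and "prob_space.indep_vars M (\<lambda>_. borel) U UNIV"
    and "\<And>j. distr M borel (U j) = uniform_measure lborel {0..1}"
    and "prob_space.indep_vars M (\<lambda>_. count_space UNIV) S UNIV"
    and "\<And>j. measure M {\<omega> \<in> space M. S j \<omega> = Plus} = p"
    and "prob_space.indep_set M
           (sets (vimage_algebra (space M) (\<lambda>\<omega> j. U j \<omega>) (\<Pi>\<^sub>M j\<in>UNIV. borel)))
           (sets (vimage_algebra (space M) (\<lambda>\<omega> j. S j \<omega>) (\<Pi>\<^sub>M j\<in>UNIV. count_space UNIV)))"
  shows "let I = intensity_measure M (restrict_space borel unit_square)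
                   (\<lambda>\<omega>. rec_permuton (\<lambda>j. U j \<omega>) (\<lambda>j. S j \<omega>))
         in absolutely_continuous Leb_square I \<and>
            rec_density p \<in> borel_measurable Leb_square \<and>
            I = density Leb_square (rec_density p)"
proof -
  let ?Sq = "restrict_space borel unit_square"
  let ?I = "intensity_measure M ?Sq (\<lambda>\<omega>. rec_permuton (\<lambda>j. U j \<omega>) (\<lambda>j. S j \<omega>))"
  let ?dens = "density Leb_square (rec_density p)"
  let ?seq = "\<lambda>\<omega>. (\<lambda>j. U j \<omega>, \<lambda>j. S j \<omega>)"
  have U_law: "distr M borel (U j) = cut_law" for j
    by (simp add: assms(5) cut_law_def)
  note seq = distr_driving_sequences[OF assms(3) less_imp_le[OF assms(1)] less_imp_le[OF assms(2)]
      assms(4) U_law assms(6,7,8)]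
  have "rec_density p \<in> borel_measurable borel"
    using measurable_rec_density by (simp add: borel_prod)
  then have dens: "rec_density p \<in> borel_measurable Leb_square"
    by (intro measurable_restrict_space1) simp
  have mean_mass: "(\<integral>\<^sup>+\<omega>. emeasure (rec_permuton (\<lambda>j. U j \<omega>) (\<lambda>j. S j \<omega>)) A \<partial>M) = emeasure ?dens A"
    if A: "A \<in> sets ?Sq" for A
  proof -
    have Ab: "A \<in> sets borel" and sub: "A \<subseteq> unit_square"
      using A unit_square_borel by (simp_all add: sets_restrict_space_iff)
    have "(\<integral>\<^sup>+\<omega>. emeasure (rec_permuton (fst (?seq \<omega>)) (snd (?seq \<omega>))) A \<partial>M) =
        (\<integral>\<^sup>+\<omega>. emeasure (rec_permuton (fst \<omega>) (snd \<omega>)) A \<partial>driving_law p)"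
      unfolding seq(2)[symmetric]
      using measurable_emeasure_rec_permuton[OF Ab sub]
      by (intro nn_integral_distr[OF seq(1), symmetric]) (simp only: measurable_distr_eq1)
    also have "\<dots> = (\<integral>\<^sup>+z. rec_density p z * indicator A z \<partial>lborel)"
      by (rule nn_integral_emeasure_rec_permuton[OF assms(1,2) Ab sub])
    also have "\<dots> = (\<integral>\<^sup>+z. rec_density p z * indicator A z * indicator unit_square z \<partial>lborel)"
      by (rule nn_integral_cong) (use sub in \<open>auto simp: indicator_def\<close>)
    also have "\<dots> = (\<integral>\<^sup>+z. rec_density p z * indicator A z \<partial>Leb_square)"
      by (rule nn_integral_restrict_space[symmetric]) (simp add: unit_square_borel)
    also have "\<dots> = emeasure ?dens A"
      by (rule emeasure_density[symmetric, OF dens]) (use A in \<open>simp add: sets_restrict_space\<close>)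
    finally show ?thesis by simp
  qed
  \<comment> \<open>\<open>measure_of\<close> keeps a set function only if it is a measure; this one is, as it agrees with \<open>emeasure ?dens\<close>\<close>
  have "?I = measure_of (space ?Sq) (sets ?Sq) (emeasure ?dens)"
    unfolding intensity_measure_def
  proof (rule measure_of_eq)
    show "sets ?Sq \<subseteq> Pow (space ?Sq)" by (rule sets.space_closed)
    fix A assume "A \<in> sigma_sets (space ?Sq) (sets ?Sq)"
    then show "(\<integral>\<^sup>+\<omega>. emeasure (rec_permuton (\<lambda>j. U j \<omega>) (\<lambda>j. S j \<omega>)) A \<partial>M) = emeasure ?dens A"
      by (intro mean_mass) (simp only: sets.sigma_sets_eq)
  qed
  also have "\<dots> = measure_of (space ?dens) (sets ?dens) (emeasure ?dens)"
    by (simp add: sets_restrict_space space_restrict_space)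
  also have "\<dots> = ?dens"
    by (rule measure_of_of_measure)
  finally have I: "?I = ?dens" .
  show ?thesis
    unfolding Let_def I using dens by (intro conjI absolutely_continuousI_density refl)
qed

end
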